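(* (Dominated convergence theorem) Let $\mathbb{L}$ be a Dedekind complete unital $f$-algebra and let $\mu$ be a proper finite $\mathbb{L}$-valued measure on a measurable space $(S,\Sigma)$. Let $f_n$ ($n\in\mathbb{N}$) and $f$ be $\mathbb{L}$-valued measurable functions on $S$ and suppose that $f_n\to f$ pointwise on $S$. If there exists $g\in\mathcal{L}^1(S,\Sigma,\mu;\mathbb{L})$ such that $|f_n|\le g$ for all $n\in\mathbb{N}$, then (1) $f$ and the $f_n$ are all integrable functions; (2) $\displaystyle\bigwedge_{n=1}^\infty\bigvee_{k=n}^\infty\int_S|f_k-f|\,\mathrm{d}\mu=0$; (3) $\displaystyle\int_Sf\,\mathrm{d}\mu=\bigvee_{n=1}^\infty\bigwedge_{k=n}^\infty\int_Sf_k\,\mathrm{d}\mu=\bigwedge_{n=1}^\infty\bigvee_{k=n}^\infty\int_Sf_k\,\mathrm{d}\mu$.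
   Context: $\mathbb{L}$ is a Dedekind complete unital $f$-algebra with unit $1$; $\mathbb{L}_1$ is the order ideal generated by $1$. $\overline{\mathbb{L}^+}=\mathbb{L}^+\cup\{\infty\}$ with $\lambda\le\infty$ for all $\lambda$. $f_n\to f$ pointwise means that for each $s\in S$ the sequence $(f_n(s))$ order converges to $f(s)$ in $\mathbb{L}$, i.e. $\limsup_nf_n(s)=f(s)=\liminf_nf_n(s)$. Order relations between functions are pointwise. A finite $\mathbb{L}$-valued measure on $(S,\Sigma)$ is a map $\mu:\Sigma\to\mathbb{L}^+$ with $\mu(\emptyset)=0$ and $\mu(\bigcup_nA_n)=\sum_n\mu(A_n)$ (supremum of partial sums) for disjoint sequences $(A_n)$ in $\Sigma$. A measurable step function is a function $\phi:S\to\mathbb{L}$ with finite range $\{\lambda_1,\dots,\lambda_n\}$ and $A_i:=\phi^{-1}(\lambda_i)\in\Sigma$; its integral is $\int_S\phi\,\mathrm{d}\mu=\sum_i\lambda_i\mu(A_i)$; it is positive if it is $\mathbb{L}^+$-valued. $\mathcal{S}(S,\Sigma;\mathbb{L}_1^+)$ is the set of measurable step functions with values in $\mathbb{L}_1^+$. $\mu$ is proper if $\int_S\varphi_n\,\mathrm{d}\mu\downarrow0$ in $\mathbb{L}$ for every sequence $(\varphi_n)$ in $\mathcal{S}(S,\Sigma;\mathbb{L}_1^+)$ with $\varphi_n\downarrow0$ pointwise in $\mathbb{L}$. $\mathcal{M}(S,\Sigma;\mathbb{L}^+)$ is the set of $f:S\to\mathbb{L}^+$ for which there is a sequence of positive measurable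 step functions $\phi_n\uparrow f$ pointwise (for each $s$, increasing with supremum $f(s)$); such a sequence can then also be chosen in $\mathcal{S}(S,\Sigma;\mathbb{L}_1^+)$, and $\int_Sf\,\mathrm{d}\mu:=\bigvee_n\int_S\phi_n\,\mathrm{d}\mu\in\overline{\mathbb{L}^+}$ for such a sequence $(\phi_n)$ in $\mathcal{S}(S,\Sigma;\mathbb{L}_1^+)$ (independent of its choice). A function $f:S\to\mathbb{L}$ is measurable if its pointwise positive and negative parts $f^+,f^-$ are in $\mathcal{M}(S,\Sigma;\mathbb{L}^+)$. A measurable $f:S\to\mathbb{L}$ is integrable if $\int_S|f|\,\mathrm{d}\mu\in\mathbb{L}$, and then $\int_Sf\,\mathrm{d}\mu:=\int_Sf^+\,\mathrm{d}\mu-\int_Sf^-\,\mathrm{d}\mu$. $\mathcal{L}^1(S,\Sigma,\mu;\mathbb{L})$ is the set of integrable $\mathbb{L}$-valued functions.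
   Formalization: In (2), |f_k − f| can fail to be measurable in the stated sense, so its integral may be undefined; there it means ∫u dμ − ∫v dμ for any |f_k − f| = u − v with u, v in M(S,Σ;L⁺) of finite integral. Where the integral is defined, (2) is unchanged. *)

theory Defs
  imports
    "HOL-Analysis.Analysis"
    "HOL-Library.Lattice_Algebras"
    "HOL-Library.Lub_Glb"
    "HOL-Library.Extended"
begin

class f_algebra = real_algebra + ordered_real_vector + lattice_ring +
  assumes f_algebra_left: "inf a b = 0 \<Longrightarrow> 0 \<le> c \<Longrightarrow> inf (c * a) b = 0"
    and f_algebra_right: "inf a b = 0 \<Longrightarrow> 0 \<le> c \<Longrightarrow> inf (a * c) b = 0"

text \<open>The unit comes from \<^class>\<open>monoid_mult\<close> rather than \<^class>\<open>ring_1\<close>, so that the zero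
  algebra is not excluded.\<close>

class dedekind_complete_unital_f_algebra =
  f_algebra + monoid_mult + conditionally_complete_lattice

definition order_ideal :: "'a::f_algebra set \<Rightarrow> bool" where
  "order_ideal I \<longleftrightarrow> subspace I \<and> (\<forall>x\<in>I. \<forall>y. \<bar>y\<bar> \<le> \<bar>x\<bar> \<longrightarrow> y \<in> I)"

definition unit_ideal :: "'l::dedekind_complete_unital_f_algebra set" where
  "unit_ideal = order_ideal hull {1}"

text \<open>Suprema and infima are used relationally (\<^const>\<open>isLub\<close>, \<^const>\<open>isGlb\<close>), because \<^const>\<open>Sup\<close> and
  \<^const>\<open>Inf\<close> of a conditionally complete lattice are unspecified on unbounded sets. In
  the limit superior and inferior, \<open>R\<close> is the partially ordered set in which they are taken.\<close>

definition increases_to :: "(nat \<Rightarrow> 'a::order) \<Rightarrow> 'a \<Rightarrow> bool" where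
  "increases_to X x \<longleftrightarrow> incseq X \<and> isLub UNIV (range X) x"

definition decreases_to :: "(nat \<Rightarrow> 'a::order) \<Rightarrow> 'a \<Rightarrow> bool" where
  "decreases_to X x \<longleftrightarrow> decseq X \<and> isGlb UNIV (range X) x"

definition is_limsup :: "'a::order set \<Rightarrow> (nat \<Rightarrow> 'a) \<Rightarrow> 'a \<Rightarrow> bool" where
  "is_limsup R X x \<longleftrightarrow> (\<exists>U. (\<forall>n. isLub R (X ` {n..}) (U n)) \<and> isGlb R (range U) x)"

definition is_liminf :: "'a::order set \<Rightarrow> (nat \<Rightarrow> 'a) \<Rightarrow> 'a \<Rightarrow> bool" where
  "is_liminf R X x \<longleftrightarrow> (\<exists>V. (\<forall>n. isGlb R (X ` {n..}) (V n)) \<and> isLub R (range V) x)"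

definition order_converges :: "(nat \<Rightarrow> 'a::order) \<Rightarrow> 'a \<Rightarrow> bool" where
  "order_converges X x \<longleftrightarrow> is_limsup UNIV X x \<and> is_liminf UNIV X x"

text \<open>The positive cone with \<open>\<infinity>\<close> adjoined; \<^type>\<open>extended\<close> also has a bottom element,
  which is left out.\<close>

definition extended_cone :: "'l::dedekind_complete_unital_f_algebra extended set" where
  "extended_cone = insert Pinf (Fin ` {x. 0 \<le> x})"

text \<open>A measurable space is given by \<^term>\<open>space M\<close> and \<^term>\<open>sets M\<close>; the
  \<^typ>\<open>ennreal\<close>-valued measure that \<open>M\<close> carries plays no role. The \<open>\<bbbL>\<close>-valued measure is
  \<open>\<mu>\<close>. Measurable step functions are \<^const>\<open>simple_function\<close>s, and only the values of
  functions on \<^term>\<open>space M\<close> matter.\<close>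

definition finite_L_measure ::
    "'s measure \<Rightarrow> ('s set \<Rightarrow> 'l::dedekind_complete_unital_f_algebra) \<Rightarrow> bool" where
  "finite_L_measure M \<mu> \<longleftrightarrow>
     (\<forall>A\<in>sets M. 0 \<le> \<mu> A) \<and> \<mu> {} = 0 \<and>
     (\<forall>A :: nat \<Rightarrow> 's set. range A \<subseteq> sets M \<longrightarrow> disjoint_family A \<longrightarrow>
        isLub UNIV (range (\<lambda>n. \<Sum>i<n. \<mu> (A i))) (\<mu> (\<Union>i. A i)))"

definition step_integral ::
    "'s measure \<Rightarrow> ('s set \<Rightarrow> 'l::dedekind_complete_unital_f_algebra) \<Rightarrow> ('s \<Rightarrow> 'l) \<Rightarrow> 'l" where
  "step_integral M \<mu> \<phi> = (\<Sum>c \<in> \<phi> ` space M. c * \<mu> (\<phi> -` {c} \<inter> space M))"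

definition positive_step ::
    "'s measure \<Rightarrow> ('s \<Rightarrow> 'l::dedekind_complete_unital_f_algebra) set" where
  "positive_step M = {\<phi>. simple_function M \<phi> \<and> (\<forall>s\<in>space M. 0 \<le> \<phi> s)}"

definition unit_ideal_step ::
    "'s measure \<Rightarrow> ('s \<Rightarrow> 'l::dedekind_complete_unital_f_algebra) set" where
  "unit_ideal_step M = {\<phi> \<in> positive_step M. \<forall>s\<in>space M. \<phi> s \<in> unit_ideal}"

definition proper_L_measure ::
    "'s measure \<Rightarrow> ('s set \<Rightarrow> 'l::dedekind_complete_unital_f_algebra) \<Rightarrow> bool" where
  "proper_L_measure M \<mu> \<longleftrightarrow>
     (\<forall>\<phi>. (\<forall>n. \<phi> n \<in> unit_ideal_step M) \<longrightarrow>
          (\<forall>s\<in>space M. decreases_to (\<lambda>n. \<phi> n s) 0) \<longrightarrow>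
          decreases_to (\<lambda>n. step_integral M \<mu> (\<phi> n)) 0)"

definition positive_measurable ::
    "'s measure \<Rightarrow> ('s \<Rightarrow> 'l::dedekind_complete_unital_f_algebra) set" where
  "positive_measurable M =
     {f. (\<forall>s\<in>space M. 0 \<le> f s) \<and>
         (\<exists>\<phi>. (\<forall>n. \<phi> n \<in> positive_step M) \<and>
              (\<forall>s\<in>space M. increases_to (\<lambda>n. \<phi> n s) (f s)))}"

text \<open>Meaningful for \<open>f\<close> in \<^const>\<open>positive_measurable\<close>.\<close>

definition positive_integral ::
    "'s measure \<Rightarrow> ('s set \<Rightarrow> 'l::dedekind_complete_unital_f_algebra) \<Rightarrow> ('s \<Rightarrow> 'l)
      \<Rightarrow> 'l extended" where
  "positive_integral M \<mu> f =
     (THE I. \<exists>\<phi>. (\<forall>n. \<phi> n \<in> unit_ideal_step M) \<and>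
                 (\<forall>s\<in>space M. increases_to (\<lambda>n. \<phi> n s) (f s)) \<and>
                 isLub extended_cone (range (\<lambda>n. Fin (step_integral M \<mu> (\<phi> n)))) I)"

definition L_measurable ::
    "'s measure \<Rightarrow> ('s \<Rightarrow> 'l::dedekind_complete_unital_f_algebra) \<Rightarrow> bool" where
  "L_measurable M f \<longleftrightarrow>
     (\<lambda>s. pprt (f s)) \<in> positive_measurable M \<and> (\<lambda>s. pprt (- f s)) \<in> positive_measurable M"

definition L_integrable ::
    "'s measure \<Rightarrow> ('s set \<Rightarrow> 'l::dedekind_complete_unital_f_algebra) \<Rightarrow> ('s \<Rightarrow> 'l) \<Rightarrow> bool" where
  "L_integrable M \<mu> f \<longleftrightarrow>
     L_measurable M f \<and> positive_integral M \<mu> (\<lambda>s. \<bar>f s\<bar>) \<in> range Fin"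

definition the_Fin :: "'a extended \<Rightarrow> 'a" where
  "the_Fin a = (THE x. a = Fin x)"

definition L_integral ::
    "'s measure \<Rightarrow> ('s set \<Rightarrow> 'l::dedekind_complete_unital_f_algebra) \<Rightarrow> ('s \<Rightarrow> 'l) \<Rightarrow> 'l" where
  "L_integral M \<mu> f =
     the_Fin (positive_integral M \<mu> (\<lambda>s. pprt (f s))) -
     the_Fin (positive_integral M \<mu> (\<lambda>s. pprt (- f s)))"

text \<open>The class \<^const>\<open>positive_measurable\<close> is not closed under nonnegative differences. For
  example, let \<open>S\<close> be the Cantor space with its Borel sets and let \<open>\<bbbL>\<close> consist of all real functions on
  \<open>S\<close>. Then \<open>s \<mapsto> indicator (- {s})\<close> is in the class, as the supremum over \<open>n\<close> of the step functions
  \<open>s \<mapsto> indicator {i. i and s differ in the first n places}\<close>, and so is the constant \<open>1\<close>.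
  Their difference \<open>s \<mapsto> indicator {s}\<close> is not: a step function below it is
  nonzero at finitely many points only. Consequently \<open>\<bar>f - g\<bar>\<close> can lie outside the
  class for measurable \<open>f\<close> and \<open>g\<close>. The integral below is \<^const>\<open>positive_integral\<close> on the class, and
  elsewhere it takes the one value compatible with additivity on differences \<open>u - v\<close> of functions in
  the class that have finite integrals. For integrable \<open>f\<close> and \<open>g\<close>, \<open>\<bar>f - g\<bar>\<close> is such a
  difference: take the supremum and the infimum of \<open>pprt f + pprt (- g)\<close> and
  \<open>pprt g + pprt (- f)\<close>.\<close>

definition nonneg_integral ::
    "'s measure \<Rightarrow> ('s set \<Rightarrow> 'l::dedekind_complete_unital_f_algebra) \<Rightarrow> ('s \<Rightarrow> 'l)
      \<Rightarrow> 'l extended" where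
  "nonneg_integral M \<mu> h =
     (if h \<in> positive_measurable M then positive_integral M \<mu> h
      else THE I. \<exists>u\<in>positive_measurable M. \<exists>v\<in>positive_measurable M. \<exists>a b.
             (\<forall>s\<in>space M. h s = u s - v s) \<and>
             positive_integral M \<mu> u = Fin a \<and> positive_integral M \<mu> v = Fin b \<and>
             I = Fin (a - b))"

end

theory Submission
  imports Defs
begin

text \<open>Differences of functions in \<^const>\<open>positive_measurable\<close> with finite integrals form a vector lattice
  containing all \<open>\<bar>f\<^sub>k - f\<bar>\<close>, but not the suprema \<open>H\<^sub>n\<close> of their tails, so a Daniell argument with the outer
  integral (defined by majorants in \<^const>\<open>positive_measurable\<close>) is needed. The classical argument covers the
  \<open>k\<close>-th term of a series up to an error \<open>e / 2\<^sup>k\<close>, which an infimum in \<open>\<bbbL>\<close> does not allow; but since the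
  integral is linear over \<open>\<bbbL>\<close>, majorants can be pasted along a countable partition of the unit, which
  restores such \<open>e\<close>-approximations for countable infima. Let \<open>A\<^sub>n\<close> be the supremum of the integrals of the finite
  suprema below \<open>H\<^sub>n\<close>. Then the outer integral of \<open>H\<^sub>n - H\<^sub>n\<^sub>+\<^sub>1\<close> is at most \<open>A\<^sub>n - A\<^sub>n\<^sub>+\<^sub>1\<close>. As \<open>H\<^sub>n\<close> decreases to \<open>0\<close>,
  summation gives \<open>A\<^sub>0 \<le> A\<^sub>0 - inf A\<^sub>n\<close>, hence \<open>inf A\<^sub>n = 0\<close>, and \<open>A\<^sub>n\<close> bounds the integrals of the later \<open>\<bar>f\<^sub>k - f\<bar>\<close>.\<close>

subsection \<open>Order limits in lattice-ordered algebras\<close>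

lemma isLub_UNIV_iff:
  fixes x :: "'a::order"
  shows "isLub UNIV A x \<longleftrightarrow> (\<forall>a\<in>A. a \<le> x) \<and> (\<forall>y. (\<forall>a\<in>A. a \<le> y) \<longrightarrow> x \<le> y)"
  unfolding isLub_def isUb_def leastP_def setle_def setge_def by auto

lemma isGlb_UNIV_iff:
  fixes x :: "'a::order"
  shows "isGlb UNIV A x \<longleftrightarrow> (\<forall>a\<in>A. x \<le> a) \<and> (\<forall>y. (\<forall>a\<in>A. y \<le> a) \<longrightarrow> y \<le> x)"
  unfolding isGlb_def isLb_def greatestP_def setle_def setge_def by auto

lemma increases_to_iff:
  "increases_to X x \<longleftrightarrow> incseq X \<and> (\<forall>n. X n \<le> x) \<and> (\<forall>y. (\<forall>n. X n \<le> y) \<longrightarrow> x \<le> y)"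
  unfolding increases_to_def isLub_UNIV_iff by auto

lemma decreases_to_iff:
  "decreases_to X x \<longleftrightarrow> decseq X \<and> (\<forall>n. x \<le> X n) \<and> (\<forall>y. (\<forall>n. y \<le> X n) \<longrightarrow> y \<le> x)"
  unfolding decreases_to_def isGlb_UNIV_iff by auto

lemma increases_toI:
  assumes "\<And>n. X n \<le> X (Suc n)" "\<And>n. X n \<le> x" "\<And>y. (\<And>n. X n \<le> y) \<Longrightarrow> x \<le> y"
  shows "increases_to X x"
  using assms unfolding increases_to_iff by (simp add: incseq_SucI)

lemma decreases_toI:
  assumes "\<And>n. X (Suc n) \<le> X n" "\<And>n. x \<le> X n" "\<And>y. (\<And>n. y \<le> X n) \<Longrightarrow> y \<le> x"
  shows "decreases_to X x"
  using assms unfolding decreases_to_iff by (simp add: decseq_SucI)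

lemma increases_toD:
  assumes "increases_to X x"
  shows "m \<le> n \<Longrightarrow> X m \<le> X n" "X n \<le> x" "(\<And>n. X n \<le> y) \<Longrightarrow> x \<le> y"
  using assms unfolding increases_to_iff incseq_def by auto

lemma decreases_toD:
  assumes "decreases_to X x"
  shows "m \<le> n \<Longrightarrow> X n \<le> X m" "x \<le> X n" "(\<And>n. y \<le> X n) \<Longrightarrow> y \<le> x"
  using assms unfolding decreases_to_iff decseq_def by auto

lemma increases_to_const: "increases_to (\<lambda>n. x) x"
  by (rule increases_toI) auto

lemma decreases_to_const: "decreases_to (\<lambda>n. x) x"
  by (rule decreases_toI) auto

lemma Sup_isLub:
  fixes A :: "'a::conditionally_complete_lattice set"
  assumes "A \<noteq> {}" "\<And>a. a \<in> A \<Longrightarrow> a \<le> u"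
  shows "isLub UNIV A (Sup A)"
  using assms by (auto simp: isLub_UNIV_iff intro!: cSup_upper cSup_least bdd_aboveI)

lemma Inf_isGlb:
  fixes A :: "'a::conditionally_complete_lattice set"
  assumes "A \<noteq> {}" "\<And>a. a \<in> A \<Longrightarrow> u \<le> a"
  shows "isGlb UNIV A (Inf A)"
  using assms by (auto simp: isGlb_UNIV_iff intro!: cInf_lower cInf_greatest bdd_belowI)

lemma increases_to_Sup:
  fixes X :: "nat \<Rightarrow> 'a::conditionally_complete_lattice"
  assumes "\<And>n. X n \<le> X (Suc n)" "\<And>n. X n \<le> u"
  shows "increases_to X (Sup (range X))"
  unfolding increases_to_def using assms Sup_isLub[of "range X" u] by (auto intro: incseq_SucI)

lemma decreases_to_Inf:
  fixes X :: "nat \<Rightarrow> 'a::conditionally_complete_lattice"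
  assumes "\<And>n. X (Suc n) \<le> X n" "\<And>n. l \<le> X n"
  shows "decreases_to X (Inf (range X))"
  unfolding decreases_to_def using assms Inf_isGlb[of "range X" l] by (auto intro: decseq_SucI)

lemma increases_to_case_nat:
  assumes X: "increases_to X x" and "a \<le> X 0"
  shows "increases_to (case_nat a X) x"
proof (rule increases_toI)
  show "case_nat a X n \<le> case_nat a X (Suc n)" for n
    using assms(2) increases_toD(1)[OF X] by (cases n) auto
  show "case_nat a X n \<le> x" for n
    using assms(2) increases_toD(2)[OF X] by (cases n) (auto intro: order_trans)
  fix y assume y: "\<And>n. case_nat a X n \<le> y"
  have "X n \<le> y" for n using y[of "Suc n"] by simp
  then show "x \<le> y" by (rule increases_toD(3)[OF X])
qed

lemma increases_to_offset:
  assumes X: "increases_to X x"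
  shows "increases_to (\<lambda>n. X (n + m)) x"
proof (rule increases_toI)
  fix y assume y: "\<And>n. X (n + m) \<le> y"
  have "X n \<le> y" for n
    using increases_toD(1)[OF X, of n "n + m"] y[of n] by (auto intro: order_trans)
  then show "x \<le> y" by (rule increases_toD(3)[OF X])
qed (auto intro: increases_toD[OF X])

primrec partial_sup :: "(nat \<Rightarrow> 'a::semilattice_sup) \<Rightarrow> nat \<Rightarrow> 'a" where
  "partial_sup X 0 = X 0"
| "partial_sup X (Suc n) = sup (partial_sup X n) (X (Suc n))"

lemma partial_sup_upper: "k \<le> n \<Longrightarrow> X k \<le> partial_sup X n"
  by (induction n) (auto simp: le_Suc_eq intro: le_supI1)

lemma partial_sup_least: "(\<And>k. k \<le> n \<Longrightarrow> X k \<le> y) \<Longrightarrow> partial_sup X n \<le> y"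
  by (induction n) auto

lemma increases_to_partial_sup:
  assumes "isLub UNIV (range X) x"
  shows "increases_to (partial_sup X) x"
proof (rule increases_toI)
  show "partial_sup X n \<le> x" for n
    using assms by (intro partial_sup_least) (auto simp: isLub_UNIV_iff)
  fix y assume "\<And>n. partial_sup X n \<le> y"
  then have "X n \<le> y" for n
    using partial_sup_upper[of n n X] by (auto intro: order_trans)
  then show "x \<le> y" using assms by (auto simp: isLub_UNIV_iff)
qed simp

section \<open>Order limits under the group and lattice operations\<close>

lemma increases_to_diff_const_left:
  fixes x :: "'a::ordered_ab_group_add"
  assumes "decreases_to X x"
  shows "increases_to (\<lambda>n. c - X n) (c - x)"
proof (rule increases_toI)
  fix y assume "\<And>n. c - X n \<le> y"
  then have "\<And>n. c - y \<le> X n" by (simp add: algebra_simps)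
  from decreases_toD(3)[OF assms this] show "c - x \<le> y" by (simp add: algebra_simps)
qed (use decreases_toD[OF assms] in \<open>auto simp: diff_left_mono\<close>)

lemma decreases_to_diff_const_left:
  fixes x :: "'a::ordered_ab_group_add"
  assumes "increases_to X x"
  shows "decreases_to (\<lambda>n. c - X n) (c - x)"
proof (rule decreases_toI)
  fix y assume "\<And>n. y \<le> c - X n"
  then have "\<And>n. X n \<le> c - y" by (simp add: algebra_simps)
  from increases_toD(3)[OF assms this] show "y \<le> c - x" by (simp add: algebra_simps)
qed (use increases_toD[OF assms] in \<open>auto simp: diff_left_mono\<close>)

lemma decreases_to_add:
  fixes x :: "'a::ordered_ab_group_add"
  assumes X: "decreases_to X x" and Y: "decreases_to Y y"
  shows "decreases_to (\<lambda>n. X n + Y n) (x + y)"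
proof (rule decreases_toI)
  fix z assume z: "\<And>n. z \<le> X n + Y n"
  \<comment> \<open>The two indices are separated: with \<open>m\<close> fixed, the bound at index
    \<open>max m n\<close> yields \<open>z \<le> X n + Y m\<close> for every \<open>n\<close>; only
    afterwards does \<open>m\<close> vary.\<close>
  have "z - Y m \<le> x" for m
  proof (rule decreases_toD(3)[OF X])
    fix n
    have "z \<le> X (max m n) + Y (max m n)" by (rule z)
    also have "\<dots> \<le> X n + Y m"
      by (intro add_mono decreases_toD(1)[OF X] decreases_toD(1)[OF Y]) auto
    finally show "z - Y m \<le> X n" by (simp add: algebra_simps)
  qed
  then have "\<And>m. z - x \<le> Y m" by (simp add: algebra_simps)
  from decreases_toD(3)[OF Y this] show "z \<le> x + y" by (simp add: algebra_simps)
qed (use decreases_toD[OF X] decreases_toD[OF Y] in \<open>auto simp: add_mono\<close>)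

text \<open>Reduces the limit theorems for sums, lattice operations and products to an estimate of
  the error by a null sequence.\<close>

lemma increases_to_squeeze:
  fixes x :: "'a::ordered_ab_group_add"
  assumes "\<And>n. X n \<le> X (Suc n)" "\<And>n. X n \<le> x" "\<And>n. x - X n \<le> Y n" "decreases_to Y 0"
  shows "increases_to X x"
proof (rule increases_toI)
  fix y assume "\<And>n. X n \<le> y"
  then have "x - y \<le> Y n" for n
    using assms(3)[of n] diff_left_mono order_trans by blast
  from decreases_toD(3)[OF assms(4) this] show "x \<le> y" by simp
qed (use assms in auto)

lemma increases_to_add:
  fixes x :: "'a::ordered_ab_group_add"
  assumes X: "increases_to X x" and Y: "increases_to Y y"
  shows "increases_to (\<lambda>n. X n + Y n) (x + y)"
proof (rule increases_to_squeeze)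
  show "decreases_to (\<lambda>n. (x - X n) + (y - Y n)) 0"
    using decreases_to_add[OF decreases_to_diff_const_left[OF X, of x]
      decreases_to_diff_const_left[OF Y, of y]] by simp
  show "X n + Y n \<le> x + y" for n
    by (intro add_mono increases_toD(2)[OF X] increases_toD(2)[OF Y])
  show "X n + Y n \<le> X (Suc n) + Y (Suc n)" for n
    by (intro add_mono increases_toD(1)[OF X] increases_toD(1)[OF Y]) auto
qed simp

text \<open>Both errors are nonnegative, so subtracting their sum brings \<open>a\<close> below
  \<open>c\<close> and \<open>b\<close> below \<open>d\<close> at once.\<close>

lemma inf_diff_inf_le:
  fixes a b c d :: "'a::lattice_ab_group_add"
  assumes "c \<le> a" "d \<le> b"
  shows "inf a b - inf c d \<le> (a - c) + (b - d)"
proof -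
  have "inf a b - ((a - c) + (b - d)) \<le> a - ((a - c) + (b - d))"
    by (intro diff_right_mono) simp
  also have "\<dots> \<le> c" using assms(2) by (simp add: algebra_simps)
  finally have 1: "inf a b - ((a - c) + (b - d)) \<le> c" .
  have "inf a b - ((a - c) + (b - d)) \<le> b - ((a - c) + (b - d))"
    by (intro diff_right_mono) simp
  also have "\<dots> \<le> d" using assms(1) by (simp add: algebra_simps)
  finally have "inf a b - ((a - c) + (b - d)) \<le> inf c d" using 1 by simp
  then show ?thesis by (metis diff_le_eq add.commute)
qed

lemma sup_diff_sup_le:
  fixes a b c d :: "'a::lattice_ab_group_add"
  assumes "c \<le> a" "d \<le> b"
  shows "sup a b - sup c d \<le> (a - c) + (b - d)"
proof -
  have "a \<le> sup c d + ((a - c) + (b - d))"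
    using add_mono[of c "sup c d" "a - c" "(a - c) + (b - d)"] assms by simp
  moreover have "b \<le> sup c d + ((a - c) + (b - d))"
    using add_mono[of d "sup c d" "b - d" "(a - c) + (b - d)"] assms by simp
  ultimately have "sup a b \<le> sup c d + ((a - c) + (b - d))" by (rule le_supI)
  then show ?thesis by (metis diff_le_eq add.commute)
qed

lemma increases_to_inf:
  fixes x :: "'a::lattice_ab_group_add"
  assumes X: "increases_to X x" and Y: "increases_to Y y"
  shows "increases_to (\<lambda>n. inf (X n) (Y n)) (inf x y)"
proof (rule increases_to_squeeze)
  show "decreases_to (\<lambda>n. (x - X n) + (y - Y n)) 0"
    using decreases_to_add[OF decreases_to_diff_const_left[OF X, of x]
      decreases_to_diff_const_left[OF Y, of y]] by simp
  show "inf x y - inf (X n) (Y n) \<le> x - X n + (y - Y n)" for n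
    by (intro inf_diff_inf_le increases_toD(2)[OF X] increases_toD(2)[OF Y])
  show "inf (X n) (Y n) \<le> inf x y" for n
    by (intro inf_mono increases_toD(2)[OF X] increases_toD(2)[OF Y])
  show "inf (X n) (Y n) \<le> inf (X (Suc n)) (Y (Suc n))" for n
    by (intro inf_mono increases_toD(1)[OF X] increases_toD(1)[OF Y]) auto
qed

lemma increases_to_sup:
  fixes x :: "'a::lattice_ab_group_add"
  assumes X: "increases_to X x" and Y: "increases_to Y y"
  shows "increases_to (\<lambda>n. sup (X n) (Y n)) (sup x y)"
proof (rule increases_to_squeeze)
  show "decreases_to (\<lambda>n. (x - X n) + (y - Y n)) 0"
    using decreases_to_add[OF decreases_to_diff_const_left[OF X, of x]
      decreases_to_diff_const_left[OF Y, of y]] by simp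
  show "sup x y - sup (X n) (Y n) \<le> x - X n + (y - Y n)" for n
    by (intro sup_diff_sup_le increases_toD(2)[OF X] increases_toD(2)[OF Y])
  show "sup (X n) (Y n) \<le> sup x y" for n
    by (intro sup_mono increases_toD(2)[OF X] increases_toD(2)[OF Y])
  show "sup (X n) (Y n) \<le> sup (X (Suc n)) (Y (Suc n))" for n
    by (intro sup_mono increases_toD(1)[OF X] increases_toD(1)[OF Y]) auto
qed

section \<open>Positive and negative parts, and squares in an f-algebra\<close>

lemma abs_eq_pprt_add: "\<bar>a\<bar> = pprt a + pprt (- a)"
  for a :: "'a::lattice_ab_group_add_abs"
  by (simp add: abs_prts pprt_neg)

lemma eq_pprt_diff: "a = pprt a - pprt (- a)"
  for a :: "'a::lattice_ab_group_add"
  using prts[of a] by (simp add: pprt_neg)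

text \<open>Translation by \<open>pprt (- a)\<close> carries the pair \<open>a\<close>,
  \<open>0\<close> to the pair \<open>pprt a\<close>, \<open>pprt (- a)\<close>, and
  \<open>inf a 0\<close> equals \<open>- pprt (- a)\<close>.\<close>

lemma inf_pprt_pprt_minus: "inf (pprt a) (pprt (- a)) = 0"
  for a :: "'a::lattice_ab_group_add"
proof -
  have "inf (pprt a) (pprt (- a)) = pprt (- a) + inf a 0"
  proof -
    have "pprt (- a) + a = pprt a"
      using eq_pprt_diff[of a] by (metis add.commute diff_add_cancel)
    then show ?thesis by (simp add: add_inf_distrib_left)
  qed
  also have "\<dots> = 0"
    by (simp add: pprt_neg flip: nprt_def)
  finally show ?thesis .
qed

context
  fixes a :: "'l::dedekind_complete_unital_f_algebra"
begin

lemma pprt_mult_pprt_minus: "pprt a * pprt (- a) = 0" and pprt_minus_mult_pprt: "pprt (- a) * pprt a = 0"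
proof -
  \<comment> \<open>Multiplication by a positive element preserves disjointness. Applied on the left
    and then on the right, it makes \<open>x * y\<close> disjoint first from \<open>x\<close> and
    then from itself.\<close>
  have *: "x * y = 0" if "inf x y = 0" "0 \<le> x" "0 \<le> y" for x y :: 'l
  proof -
    have "inf (x * y) x = 0"
      using f_algebra_left[of y x x] that by (simp add: inf_commute)
    then have "inf x (x * y) = 0" by (simp add: inf_commute)
    from f_algebra_right[OF this \<open>0 \<le> y\<close>] show ?thesis by simp
  qed
  show "pprt a * pprt (- a) = 0" using inf_pprt_pprt_minus[of a] by (intro *) auto
  show "pprt (- a) * pprt a = 0" using inf_pprt_pprt_minus[of a]
    by (intro *) (auto simp: inf_commute)
qed

text \<open>The mixed products of the two parts vanish, which leaves a sum of products of positive
  elements.\<close>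

lemma f_algebra_square_nonneg: "0 \<le> a * a"
proof -
  have "a * a = (pprt a - pprt (- a)) * (pprt a - pprt (- a))"
    using eq_pprt_diff[of a] by simp
  also have "\<dots> = pprt a * pprt a + pprt (- a) * pprt (- a)"
    by (simp add: algebra_simps pprt_mult_pprt_minus pprt_minus_mult_pprt)
  also have "\<dots> \<ge> 0" by simp
  finally show ?thesis .
qed

end

section \<open>The Archimedean property and order continuity of the product\<close>

lemma f_algebra_one_nonneg: "0 \<le> (1::'l::dedekind_complete_unital_f_algebra)"
  using f_algebra_square_nonneg[of "1::'l"] by simp

text \<open>Dedekind completeness supplies the supremum \<open>s\<close> of the multiples
  \<open>real (Suc n) *\<^sub>R x\<close>. Then \<open>s - x\<close> is an upper bound as well, so
  \<open>s \<le> s - x\<close>.\<close>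

lemma archimedean:
  fixes x y :: "'l::dedekind_complete_unital_f_algebra"
  assumes "\<And>n. x \<le> (1 / real (Suc n)) *\<^sub>R y"
  shows "x \<le> 0"
proof -
  have le: "real (Suc n) *\<^sub>R x \<le> y" for n
    using scaleR_left_mono[OF assms[of n], of "real (Suc n)"] by simp
  define s where "s = Sup (range (\<lambda>n. real (Suc n) *\<^sub>R x))"
  have s: "isLub UNIV (range (\<lambda>n. real (Suc n) *\<^sub>R x)) s"
    unfolding s_def by (rule Sup_isLub) (use le in auto)
  have "real (Suc n) *\<^sub>R x \<le> s - x" for n
  proof -
    have "real (Suc (Suc n)) *\<^sub>R x \<le> s" using s unfolding isLub_UNIV_iff by blast
    then show ?thesis by (simp add: algebra_simps scaleR_2)
  qed
  then have "s \<le> s - x" using s unfolding isLub_UNIV_iff by blast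
  then show ?thesis by (simp add: algebra_simps)
qed

lemma le_if_le_add_unit:
  fixes x y :: "'l::dedekind_complete_unital_f_algebra"
  assumes "\<And>e. 0 < e \<Longrightarrow> x \<le> y + e *\<^sub>R 1"
  shows "x \<le> y"
proof -
  have "x - y \<le> 0"
    by (rule archimedean[of _ 1]) (use assms in \<open>auto simp: algebra_simps\<close>)
  then show ?thesis by simp
qed

text \<open>This comes from \<open>(x - 2n)\<^sup>2 \<ge> 0\<close>. It yields all the continuity properties of
  the product and of truncation that are needed.\<close>

lemma diff_scaleR_one_le_square:
  fixes x :: "'l::dedekind_complete_unital_f_algebra"
  shows "x - real (Suc n) *\<^sub>R 1 \<le> (1 / real (Suc n)) *\<^sub>R ((1 / 4) *\<^sub>R (x * x))"
proof -
  define r where "r = real (Suc n)"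
  have r: "r > 0" by (simp add: r_def)
  have "0 \<le> (x - (2 * r) *\<^sub>R 1) * (x - (2 * r) *\<^sub>R 1)" by (rule f_algebra_square_nonneg)
  also have "\<dots> = x * x - (4 * r) *\<^sub>R x + (4 * r * r) *\<^sub>R 1"
    by (simp add: algebra_simps) (simp flip: scaleR_add_left)
  finally have "0 \<le> (1 / (4 * r)) *\<^sub>R (x * x - (4 * r) *\<^sub>R x + (4 * r * r) *\<^sub>R 1)"
    using r by (intro scaleR_nonneg_nonneg) auto
  also have "\<dots> = (1 / (4 * r)) *\<^sub>R (x * x) - x + r *\<^sub>R 1"
    using r by (simp add: scaleR_add_right scaleR_diff_right)
  finally show ?thesis unfolding r_def[symmetric] by (simp add: algebra_simps)
qed

text \<open>\<open>1\<close> is a weak order unit: what the truncation cuts off is the positive part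
  of \<open>x - real (Suc n) *\<^sub>R 1\<close>, which is at most \<open>1 / real (Suc n)\<close>
  times a fixed multiple of \<open>x * x\<close>.\<close>

lemma increases_to_truncation:
  fixes x :: "'l::dedekind_complete_unital_f_algebra"
  shows "increases_to (\<lambda>n. inf x (real (Suc n) *\<^sub>R 1)) x"
proof (rule increases_toI)
  show "inf x (real (Suc n) *\<^sub>R 1) \<le> inf x (real (Suc (Suc n)) *\<^sub>R 1)" for n
    using f_algebra_one_nonneg by (intro inf_mono scaleR_right_mono) auto
  fix y assume y: "\<And>n. inf x (real (Suc n) *\<^sub>R 1) \<le> y"
  have "x - y \<le> (1 / real (Suc n)) *\<^sub>R ((1 / 4) *\<^sub>R (x * x))" for n
  proof -
    have "x - inf x (real (Suc n) *\<^sub>R 1) = sup 0 (x - real (Suc n) *\<^sub>R 1)"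
      by (simp only: diff_conv_add_uminus neg_inf_eq_sup add_sup_distrib_left) simp
    also have "\<dots> \<le> (1 / real (Suc n)) *\<^sub>R ((1 / 4) *\<^sub>R (x * x))"
      using diff_scaleR_one_le_square[of x n] f_algebra_square_nonneg[of x]
      by (intro le_supI scaleR_nonneg_nonneg) auto
    finally show ?thesis
      using y[of n] by (meson diff_left_mono order_trans)
  qed
  from archimedean[OF this] show "x \<le> y" by simp
qed simp

text \<open>As \<open>h\<close> need not lie below a multiple of \<open>1\<close>, it is compared
  with \<open>real (Suc m) *\<^sub>R 1\<close>. The excess contributes at most \<open>?R\<close>
  because \<open>e n \<le> 1\<close>, and the rest is a multiple of the null sequence
  \<open>e\<close>. Letting \<open>m\<close> grow removes \<open>?R\<close>.\<close>

lemma decreases_to_mult_right: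
  fixes h :: "'l::dedekind_complete_unital_f_algebra"
  assumes e: "decreases_to e 0" and e1: "\<And>n. e n \<le> 1" and h: "0 \<le> h"
  shows "decreases_to (\<lambda>n. e n * h) 0"
proof (rule decreases_toI)
  show "e (Suc n) * h \<le> e n * h" for n
    using decreases_toD(1)[OF e, of n "Suc n"] h by (simp add: mult_right_mono)
  show "0 \<le> e n * h" for n
    using decreases_toD(2)[OF e, of n] h by simp
  fix y assume y: "\<And>n. y \<le> e n * h"
  show "y \<le> 0"
  proof (rule archimedean)
    fix m
    let ?R = "(1 / real (Suc m)) *\<^sub>R ((1 / 4) *\<^sub>R (h * h))"
    have R: "0 \<le> ?R" using h by (simp add: scaleR_nonneg_nonneg)
    have "y - ?R \<le> real (Suc m) *\<^sub>R e n" for n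
    proof -
      have "e n * (h - real (Suc m) *\<^sub>R 1) \<le> e n * ?R"
        by (intro mult_left_mono diff_scaleR_one_le_square decreases_toD(2)[OF e])
      also have "\<dots> \<le> 1 * ?R" by (intro mult_right_mono e1 R)
      finally show ?thesis using y[of n] by (simp add: algebra_simps)
    qed
    then have "(1 / real (Suc m)) *\<^sub>R (y - ?R) \<le> e n" for n
      using scaleR_left_mono[of "y - ?R" "real (Suc m) *\<^sub>R e n" "1 / real (Suc m)"] by simp
    from decreases_toD(3)[OF e this]
    have "(1 / real (Suc m)) *\<^sub>R (y - ?R) \<le> 0" .
    from scaleR_left_mono[OF this, of "real (Suc m)"] show "y \<le> ?R" by simp
  qed
qed

lemma increases_to_mult_left:
  fixes q :: "'l::dedekind_complete_unital_f_algebra"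
  assumes X: "increases_to X x" and q: "0 \<le> q" "q \<le> 1"
  shows "increases_to (\<lambda>n. q * X n) (q * x)"
proof (rule increases_to_squeeze)
  show "decreases_to (\<lambda>n. x - X n) 0"
    using decreases_to_diff_const_left[OF X, of x] by simp
  show "q * x - q * X n \<le> x - X n" for n
    using mult_right_mono[OF q(2), of "x - X n"] increases_toD(2)[OF X, of n]
    by (simp add: algebra_simps)
qed (use increases_toD[OF X] q in \<open>auto intro!: mult_left_mono\<close>)

subsection \<open>Step functions with values in the unit ideal\<close>

text \<open>A hull belongs to the class in which it is taken once that class is closed under
  intersections.\<close>

lemma order_ideal_unit_ideal: "order_ideal (unit_ideal :: 'l::dedekind_complete_unital_f_algebra set)"
  unfolding unit_ideal_def
proof (rule hull_in)
  fix T :: "'l set set" assume "\<forall>I\<in>T. order_ideal I"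
  then show "order_ideal (\<Inter>T)"
    unfolding order_ideal_def by (auto intro!: subspace_Inter)
qed

lemma one_in_unit_ideal: "1 \<in> unit_ideal"
  unfolding unit_ideal_def by (simp add: hull_inc)

lemma unit_ideal_solid:
  assumes "y \<in> unit_ideal" "0 \<le> x" "x \<le> y"
  shows "x \<in> unit_ideal"
proof -
  have "\<bar>x\<bar> \<le> \<bar>y\<bar>" using assms by simp
  then show ?thesis using order_ideal_unit_ideal assms(1) unfolding order_ideal_def by blast
qed

lemma unit_ideal_add: "x \<in> unit_ideal \<Longrightarrow> y \<in> unit_ideal \<Longrightarrow> x + y \<in> unit_ideal"
  using order_ideal_unit_ideal unfolding order_ideal_def by (blast intro: subspace_add)

lemma unit_ideal_scaleR_one: "r *\<^sub>R 1 \<in> unit_ideal"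
  using order_ideal_unit_ideal one_in_unit_ideal unfolding order_ideal_def by (blast intro: subspace_scale)

lemma unit_ideal_zero: "0 \<in> unit_ideal"
  using unit_ideal_scaleR_one[of 0] by simp

lemma unit_ideal_mult_left:
  assumes "x \<in> unit_ideal" "0 \<le> x" "0 \<le> q" "q \<le> 1"
  shows "q * x \<in> unit_ideal"
  using unit_ideal_solid[OF assms(1), of "q * x"] mult_right_mono[OF assms(4,2)] assms by simp

lemma unit_ideal_stepI:
  assumes "simple_function M \<phi>" "\<And>s. s \<in> space M \<Longrightarrow> 0 \<le> \<phi> s"
    "\<And>s. s \<in> space M \<Longrightarrow> \<phi> s \<in> unit_ideal"
  shows "\<phi> \<in> unit_ideal_step M"
  using assms unfolding unit_ideal_step_def positive_step_def by auto

lemma unit_ideal_stepD: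
  assumes "\<phi> \<in> unit_ideal_step M"
  shows "simple_function M \<phi>" "s \<in> space M \<Longrightarrow> 0 \<le> \<phi> s" "s \<in> space M \<Longrightarrow> \<phi> s \<in> unit_ideal"
  using assms unfolding unit_ideal_step_def positive_step_def by auto

lemma positive_stepD:
  assumes "\<phi> \<in> positive_step M"
  shows "simple_function M \<phi>" "s \<in> space M \<Longrightarrow> 0 \<le> \<phi> s"
  using assms unfolding positive_step_def by auto

lemma unit_ideal_step_solid:
  assumes "\<psi> \<in> unit_ideal_step M" "simple_function M \<phi>"
    "\<And>s. s \<in> space M \<Longrightarrow> 0 \<le> \<phi> s \<and> \<phi> s \<le> \<psi> s"
  shows "\<phi> \<in> unit_ideal_step M"
  using assms(2,3) unit_ideal_stepD(3)[OF assms(1)] unit_ideal_solid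
  by (intro unit_ideal_stepI) blast+

lemma unit_ideal_step_add:
  assumes "\<phi> \<in> unit_ideal_step M" "\<psi> \<in> unit_ideal_step M"
  shows "(\<lambda>s. \<phi> s + \<psi> s) \<in> unit_ideal_step M"
proof (rule unit_ideal_stepI)
  show "simple_function M (\<lambda>s. \<phi> s + \<psi> s)"
    by (rule simple_function_compose2[OF unit_ideal_stepD(1)[OF assms(1)] unit_ideal_stepD(1)[OF assms(2)]])
qed (simp_all add: unit_ideal_stepD[OF assms(1)] unit_ideal_stepD[OF assms(2)] unit_ideal_add)

lemma unit_ideal_step_sup:
  assumes "\<phi> \<in> unit_ideal_step M" "\<psi> \<in> unit_ideal_step M"
  shows "(\<lambda>s. sup (\<phi> s) (\<psi> s)) \<in> unit_ideal_step M"
proof (rule unit_ideal_step_solid[OF unit_ideal_step_add[OF assms]])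
  show "simple_function M (\<lambda>s. sup (\<phi> s) (\<psi> s))"
    by (rule simple_function_compose2[OF unit_ideal_stepD(1)[OF assms(1)] unit_ideal_stepD(1)[OF assms(2)]])
qed (simp add: unit_ideal_stepD[OF assms(1)] unit_ideal_stepD[OF assms(2)] le_supI1)

lemma unit_ideal_step_inf:
  assumes "\<phi> \<in> unit_ideal_step M" "\<psi> \<in> unit_ideal_step M"
  shows "(\<lambda>s. inf (\<phi> s) (\<psi> s)) \<in> unit_ideal_step M"
proof (rule unit_ideal_step_solid[OF assms(1)])
  show "simple_function M (\<lambda>s. inf (\<phi> s) (\<psi> s))"
    by (rule simple_function_compose2[OF unit_ideal_stepD(1)[OF assms(1)] unit_ideal_stepD(1)[OF assms(2)]])
qed (simp add: unit_ideal_stepD[OF assms(1)] unit_ideal_stepD[OF assms(2)])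

lemma unit_ideal_step_mult_left:
  assumes "\<phi> \<in> unit_ideal_step M" "0 \<le> q" "q \<le> 1"
  shows "(\<lambda>s. q * \<phi> s) \<in> unit_ideal_step M"
proof (rule unit_ideal_stepI)
  show "simple_function M (\<lambda>s. q * \<phi> s)"
    by (rule simple_function_compose1[OF unit_ideal_stepD(1)[OF assms(1)]])
qed (simp_all add: unit_ideal_stepD[OF assms(1)] assms unit_ideal_mult_left)

text \<open>Truncating at \<open>n \<cdot> 1\<close> turns an approximation by arbitrary positive step functions
  into one with values in the unit ideal.\<close>

lemma positive_measurable_unit_ideal_step:
  assumes "w \<in> positive_measurable M"
  obtains \<phi> where "\<And>n. \<phi> n \<in> unit_ideal_step M"
    "\<And>s. s \<in> space M \<Longrightarrow> increases_to (\<lambda>n. \<phi> n s) (w s)"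
proof -
  obtain \<phi> where \<phi>: "\<And>n. \<phi> n \<in> positive_step M"
    and lim: "\<And>s. s \<in> space M \<Longrightarrow> increases_to (\<lambda>n. \<phi> n s) (w s)"
    using assms unfolding positive_measurable_def by auto
  let ?\<psi> = "\<lambda>n s. inf (\<phi> n s) (real (Suc n) *\<^sub>R 1)"
  have pos: "0 \<le> real (Suc n) *\<^sub>R (1::'b)" for n
    by (intro scaleR_nonneg_nonneg f_algebra_one_nonneg) simp
  show thesis
  proof
    show "?\<psi> n \<in> unit_ideal_step M" for n
    proof (rule unit_ideal_stepI)
      show "simple_function M (?\<psi> n)"
        by (rule simple_function_compose1[OF positive_stepD(1)[OF \<phi>]])
      fix s assume s: "s \<in> space M"
      show "0 \<le> ?\<psi> n s" using positive_stepD(2)[OF \<phi> s] pos by simp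
      then show "?\<psi> n s \<in> unit_ideal"
        by (rule unit_ideal_solid[OF unit_ideal_scaleR_one[of "real (Suc n)"]]) simp
    qed
    fix s assume s: "s \<in> space M"
    note inc = lim[OF s]
    show "increases_to (\<lambda>n. ?\<psi> n s) (w s)"
    proof (rule increases_toI)
      show "?\<psi> n s \<le> ?\<psi> (Suc n) s" for n
        by (intro inf_mono increases_toD(1)[OF inc] scaleR_right_mono f_algebra_one_nonneg) auto
      show "?\<psi> n s \<le> w s" for n
        by (intro le_infI1 increases_toD(2)[OF inc])
      fix y assume y: "\<And>n. ?\<psi> n s \<le> y"
      \<comment> \<open>Here \<open>m\<close> stays fixed while the height of truncation grows;
        index and height are then both covered by \<open>?\<psi> (max m n)\<close>.\<close>
      have "\<phi> m s \<le> y" for m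
      proof (rule increases_toD(3)[OF increases_to_truncation])
        fix n
        have "inf (\<phi> m s) (real (Suc n) *\<^sub>R 1) \<le> ?\<psi> (max m n) s"
          by (intro inf_mono increases_toD(1)[OF inc] scaleR_right_mono f_algebra_one_nonneg) auto
        also have "\<dots> \<le> y" by (rule y)
        finally show "inf (\<phi> m s) (real (Suc n) *\<^sub>R 1) \<le> y" .
      qed
      then show "w s \<le> y" by (rule increases_toD(3)[OF inc])
    qed
  qed
qed

lemma positive_measurable_add:
  assumes "u \<in> positive_measurable M" "v \<in> positive_measurable M"
  shows "(\<lambda>s. u s + v s) \<in> positive_measurable M"
proof -
  obtain \<phi> where \<phi>: "\<forall>n. \<phi> n \<in> positive_step M"
    "\<forall>s\<in>space M. increases_to (\<lambda>n. \<phi> n s) (u s)"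
    using assms(1) unfolding positive_measurable_def by blast
  obtain \<psi> where \<psi>: "\<forall>n. \<psi> n \<in> positive_step M"
    "\<forall>s\<in>space M. increases_to (\<lambda>n. \<psi> n s) (v s)"
    using assms(2) unfolding positive_measurable_def by blast
  have "simple_function M (\<lambda>s. \<phi> n s + \<psi> n s)" for n
    using \<phi>(1) \<psi>(1) by (intro simple_function_compose2[where h="(+)"] positive_stepD(1)) auto
  then have "\<forall>n. (\<lambda>s. \<phi> n s + \<psi> n s) \<in> positive_step M"
    using \<phi>(1) \<psi>(1) by (simp add: positive_step_def)
  moreover have "\<forall>s\<in>space M. increases_to (\<lambda>n. \<phi> n s + \<psi> n s) (u s + v s)"
    using \<phi>(2) \<psi>(2) by (simp add: increases_to_add)
  moreover have "\<forall>s\<in>space M. 0 \<le> u s + v s"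
    using assms unfolding positive_measurable_def by simp
  ultimately show ?thesis
    unfolding positive_measurable_def mem_Collect_eq
    by (intro conjI exI[of _ "\<lambda>n s. \<phi> n s + \<psi> n s"])
qed

subsection \<open>The integral of nonnegative functions\<close>

locale proper_L_measure_space =
  fixes M :: "'s measure" and \<mu> :: "'s set \<Rightarrow> 'l::dedekind_complete_unital_f_algebra"
  assumes finite_L_measure: "finite_L_measure M \<mu>"
    and proper: "proper_L_measure M \<mu>"
begin

section \<open>Finite additivity and the integral of step functions\<close>

lemma measure_nonneg: "A \<in> sets M \<Longrightarrow> 0 \<le> \<mu> A"
  using finite_L_measure unfolding finite_L_measure_def by blast

lemma measure_empty: "\<mu> {} = 0"
  using finite_L_measure unfolding finite_L_measure_def by blast

text \<open>Countable additivity for the sequence \<open>A, B, {}, {}, ...\<close>, whose partial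
  sums stay constant after two terms.\<close>

lemma measure_Un:
  assumes A: "A \<in> sets M" and B: "B \<in> sets M" and disj: "A \<inter> B = {}"
  shows "\<mu> (A \<union> B) = \<mu> A + \<mu> B"
proof -
  have "disjoint_family (binaryset A B)"
    using disj by (auto simp: disjoint_family_on_def binaryset_def)
  moreover have "range (binaryset A B) \<subseteq> sets M"
    using A B by (simp add: range_binaryset_eq)
  ultimately have lub: "isLub UNIV (range (\<lambda>n. \<Sum>i<n. \<mu> (binaryset A B i))) (\<mu> (A \<union> B))"
    using finite_L_measure unfolding finite_L_measure_def by (metis UN_binaryset_eq)
  have *: "(\<Sum>i<n. \<mu> (binaryset A B i)) = (if n = 0 then 0 else if n = 1 then \<mu> A else \<mu> A + \<mu> B)" for n
  proof (induction n)
    case (Suc n)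
    then show ?case by (cases n) (auto simp: binaryset_def measure_empty)
  qed simp
  have "(\<Sum>i<n. \<mu> (binaryset A B i)) \<le> \<mu> A + \<mu> B" for n
    using measure_nonneg[OF A] measure_nonneg[OF B] by (simp add: *)
  then have "\<mu> (A \<union> B) \<le> \<mu> A + \<mu> B" using lub unfolding isLub_UNIV_iff by auto
  moreover have "(\<Sum>i<2. \<mu> (binaryset A B i)) \<le> \<mu> (A \<union> B)"
    using lub unfolding isLub_UNIV_iff by blast
  ultimately show ?thesis by (simp add: *)
qed

lemma measure_finite_UN:
  assumes "finite I" "\<And>i. i \<in> I \<Longrightarrow> A i \<in> sets M" "disjoint_family_on A I"
  shows "\<mu> (\<Union>i\<in>I. A i) = (\<Sum>i\<in>I. \<mu> (A i))"
  using assms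
proof (induction I)
  case (insert i I)
  have "A i \<inter> A j = {}" if "j \<in> I" for j
    using that insert.hyps by (intro disjoint_family_onD[OF insert.prems(2)]) auto
  then have "A i \<inter> (\<Union>j\<in>I. A j) = {}" by blast
  then have "\<mu> (A i \<union> (\<Union>i\<in>I. A i)) = \<mu> (A i) + \<mu> (\<Union>i\<in>I. A i)"
    using insert.hyps insert.prems(1) by (intro measure_Un) auto
  moreover have "disjoint_family_on A I"
    using insert.prems(2) by (rule disjoint_family_on_mono[rotated]) blast
  ultimately show ?case using insert.hyps insert.IH insert.prems(1) by simp
qed (simp add: measure_empty)

abbreviation "I\<^sub>s \<equiv> step_integral M \<mu>"

text \<open>Allows the integral to be computed on a finer partition than the level sets of
  \<open>\<phi>\<close>. With a pair of step functions as \<open>\<psi>\<close>, both components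
  live on one partition, and additivity and monotonicity can be checked term by term.\<close>

lemma step_integral_factor:
  assumes \<psi>: "simple_function M \<psi>" and eq: "\<And>s. s \<in> space M \<Longrightarrow> \<phi> s = F (\<psi> s)"
  shows "I\<^sub>s \<phi> = (\<Sum>b\<in>\<psi> ` space M. F b * \<mu> (\<psi> -` {b} \<inter> space M))"
proof -
  let ?B = "\<psi> ` space M"
  have fin: "finite ?B" using \<psi> by (simp add: simple_function_def)
  have img: "\<phi> ` space M = F ` ?B" using eq by (auto simp: image_iff)
  have "c * \<mu> (\<phi> -` {c} \<inter> space M) = (\<Sum>b\<in>{b \<in> ?B. F b = c}. F b * \<mu> (\<psi> -` {b} \<inter> space M))" for c
  proof -
    have "\<phi> -` {c} \<inter> space M = (\<Union>b\<in>{b \<in> ?B. F b = c}. \<psi> -` {b} \<inter> space M)"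
      using eq by auto
    then have "\<mu> (\<phi> -` {c} \<inter> space M) = (\<Sum>b\<in>{b \<in> ?B. F b = c}. \<mu> (\<psi> -` {b} \<inter> space M))"
      using fin simple_functionD(2)[OF \<psi>]
      by (simp only:) (intro measure_finite_UN, auto simp: disjoint_family_on_def)
    then show ?thesis by (simp add: sum_distrib_left)
  qed
  then have "I\<^sub>s \<phi> = (\<Sum>c\<in>F ` ?B. \<Sum>b\<in>{b \<in> ?B. F b = c}. F b * \<mu> (\<psi> -` {b} \<inter> space M))"
    unfolding step_integral_def img by simp
  also have "\<dots> = (\<Sum>b\<in>?B. F b * \<mu> (\<psi> -` {b} \<inter> space M))"
    using fin by (intro sum.group) auto
  finally show ?thesis .
qed

lemma step_integral_add:
  assumes "simple_function M \<phi>" "simple_function M \<psi>"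
  shows "I\<^sub>s (\<lambda>s. \<phi> s + \<psi> s) = I\<^sub>s \<phi> + I\<^sub>s \<psi>"
proof -
  note p = simple_function_Pair[OF assms]
  show ?thesis
    by (simp add: step_integral_factor[OF p, of _ "\<lambda>b. fst b + snd b"] step_integral_factor[OF p, of _ fst]
      step_integral_factor[OF p, of _ snd] distrib_right sum.distrib)
qed

lemma step_integral_mono:
  assumes "simple_function M \<phi>" "simple_function M \<psi>" "\<And>s. s \<in> space M \<Longrightarrow> \<phi> s \<le> \<psi> s"
  shows "I\<^sub>s \<phi> \<le> I\<^sub>s \<psi>"
proof -
  note p = simple_function_Pair[OF assms(1,2)]
  have "fst b * m \<le> snd b * m" if "b \<in> (\<lambda>s. (\<phi> s, \<psi> s)) ` space M" "0 \<le> m" for b m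
    using that assms(3) by (auto intro: mult_right_mono)
  then show ?thesis
    using simple_functionD(2)[OF p]
    by (simp add: step_integral_factor[OF p, of _ fst] step_integral_factor[OF p, of _ snd] measure_nonneg sum_mono)
qed

lemma step_integral_mult_left:
  assumes "simple_function M \<phi>"
  shows "I\<^sub>s (\<lambda>s. q * \<phi> s) = q * I\<^sub>s \<phi>"
  by (simp add: step_integral_factor[OF assms, of _ "\<lambda>b. q * b"] step_integral_factor[OF assms, of _ "\<lambda>b. b"]
      mult.assoc sum_distrib_left)

lemma step_integral_nonneg:
  assumes "\<phi> \<in> unit_ideal_step M"
  shows "0 \<le> I\<^sub>s \<phi>"
  using unit_ideal_stepD[OF assms] simple_functionD(2)[of M \<phi>]
  unfolding step_integral_def by (auto intro!: sum_nonneg mult_nonneg_nonneg measure_nonneg)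

text \<open>Properness enters only here.\<close>

lemma step_integral_le_lim:
  assumes \<phi>: "\<phi> \<in> unit_ideal_step M" and \<psi>: "\<And>n. \<psi> n \<in> unit_ideal_step M"
    and lim: "\<And>s. s \<in> space M \<Longrightarrow> increases_to (\<lambda>n. \<psi> n s) (w s)"
    and le: "\<And>s. s \<in> space M \<Longrightarrow> \<phi> s \<le> w s"
    and B: "\<And>n. I\<^sub>s (\<psi> n) \<le> B"
  shows "I\<^sub>s \<phi> \<le> B"
proof -
  \<comment> \<open>The part of \<open>\<phi>\<close> not yet covered by \<open>\<psi> n\<close>. It
    lies below \<open>\<phi>\<close>, so it keeps values in the unit ideal, and it decreases to
    \<open>0\<close> because \<open>\<phi> \<le> w\<close>.\<close>
  define d where "d n s = \<phi> s - inf (\<phi> s) (\<psi> n s)" for n s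
  have sf: "simple_function M (d n)" for n
    unfolding d_def
    by (rule simple_function_compose2[where h="\<lambda>a b. a - inf a b", OF unit_ideal_stepD(1)[OF \<phi>] unit_ideal_stepD(1)[OF \<psi>]])
  have d: "d n \<in> unit_ideal_step M" for n
  proof (rule unit_ideal_step_solid[OF \<phi> sf])
    fix s assume s: "s \<in> space M"
    have "0 \<le> inf (\<phi> s) (\<psi> n s)" "inf (\<phi> s) (\<psi> n s) \<le> \<phi> s"
      using unit_ideal_stepD(2)[OF \<phi> s] unit_ideal_stepD(2)[OF \<psi> s] by simp_all
    then show "0 \<le> d n s \<and> d n s \<le> \<phi> s"
      unfolding d_def by (metis diff_ge_0_iff_ge diff_le_eq le_add_same_cancel1)
  qed
  have "decreases_to (\<lambda>n. d n s) 0" if s: "s \<in> space M" for s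
    using decreases_to_diff_const_left[OF increases_to_inf[OF increases_to_const lim[OF s]], of "\<phi> s" "\<phi> s"] le[OF s]
    by (simp add: d_def inf_absorb1)
  then have dec: "decreases_to (\<lambda>n. I\<^sub>s (d n)) 0"
    using proper d unfolding proper_L_measure_def by blast
  have "I\<^sub>s \<phi> - B \<le> I\<^sub>s (d n)" for n
  proof -
    have "I\<^sub>s \<phi> = I\<^sub>s (\<lambda>s. d n s + inf (\<phi> s) (\<psi> n s))"
      unfolding d_def by (simp only: diff_add_cancel)
    also have "\<dots> = I\<^sub>s (d n) + I\<^sub>s (\<lambda>s. inf (\<phi> s) (\<psi> n s))"
      by (intro step_integral_add sf unit_ideal_stepD(1)[OF unit_ideal_step_inf[OF \<phi> \<psi>]])
    also have "I\<^sub>s (\<lambda>s. inf (\<phi> s) (\<psi> n s)) \<le> I\<^sub>s (\<psi> n)"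
      by (intro step_integral_mono unit_ideal_stepD(1)[OF unit_ideal_step_inf[OF \<phi> \<psi>]] unit_ideal_stepD(1)[OF \<psi>]) simp
    also have "I\<^sub>s (\<psi> n) \<le> B" by (rule B)
    finally show ?thesis by (simp add: diff_le_eq)
  qed
  from decreases_toD(3)[OF dec this] show ?thesis by simp
qed

text \<open>This includes membership in \<^const>\<open>positive_measurable\<close> and finiteness of the integral.\<close>

definition has_pos_integral :: "('s \<Rightarrow> 'l) \<Rightarrow> 'l \<Rightarrow> bool" where
  "has_pos_integral w j \<longleftrightarrow> (\<exists>\<phi>. (\<forall>n. \<phi> n \<in> unit_ideal_step M) \<and>
     (\<forall>s\<in>space M. increases_to (\<lambda>n. \<phi> n s) (w s)) \<and> increases_to (\<lambda>n. I\<^sub>s (\<phi> n)) j)"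

lemma has_pos_integralE:
  assumes "has_pos_integral w j"
  obtains \<phi> where "\<And>n. \<phi> n \<in> unit_ideal_step M"
    "\<And>s. s \<in> space M \<Longrightarrow> increases_to (\<lambda>n. \<phi> n s) (w s)" "increases_to (\<lambda>n. I\<^sub>s (\<phi> n)) j"
  using assms unfolding has_pos_integral_def by blast

lemma has_pos_integral_lim:
  assumes \<phi>: "\<And>n. \<phi> n \<in> unit_ideal_step M"
    and lim: "\<And>s. s \<in> space M \<Longrightarrow> increases_to (\<lambda>n. \<phi> n s) (w s)"
    and B: "\<And>n. I\<^sub>s (\<phi> n) \<le> B"
  shows "\<exists>j\<le>B. has_pos_integral w j \<and> increases_to (\<lambda>n. I\<^sub>s (\<phi> n)) j"
proof -
  have inc: "I\<^sub>s (\<phi> n) \<le> I\<^sub>s (\<phi> (Suc n))" for n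
    by (intro step_integral_mono unit_ideal_stepD(1)[OF \<phi>] increases_toD(1)[OF lim]) auto
  have "isLub UNIV (range (\<lambda>n. I\<^sub>s (\<phi> n))) (Sup (range (\<lambda>n. I\<^sub>s (\<phi> n))))"
    by (rule Sup_isLub) (use B in auto)
  then have *: "increases_to (\<lambda>n. I\<^sub>s (\<phi> n)) (Sup (range (\<lambda>n. I\<^sub>s (\<phi> n))))"
    unfolding increases_to_def using inc by (simp add: incseq_SucI)
  then have "has_pos_integral w (Sup (range (\<lambda>n. I\<^sub>s (\<phi> n))))"
    unfolding has_pos_integral_def using \<phi> lim by blast
  then show ?thesis using * increases_toD(3)[OF * B] by blast
qed

lemma step_integral_le_has_pos_integral:
  assumes "\<phi> \<in> unit_ideal_step M" "has_pos_integral w j" "\<And>s. s \<in> space M \<Longrightarrow> \<phi> s \<le> w s"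
  shows "I\<^sub>s \<phi> \<le> j"
  using assms(2)
proof (rule has_pos_integralE)
  fix \<psi> assume "\<And>n. \<psi> n \<in> unit_ideal_step M" "\<And>s. s \<in> space M \<Longrightarrow> increases_to (\<lambda>n. \<psi> n s) (w s)"
    "increases_to (\<lambda>n. I\<^sub>s (\<psi> n)) j"
  from step_integral_le_lim[OF assms(1) this(1,2) assms(3) increases_toD(2)[OF this(3)]] show ?thesis .
qed

lemma has_pos_integral_mono:
  assumes "has_pos_integral w j" "has_pos_integral w' j'" "\<And>s. s \<in> space M \<Longrightarrow> w s \<le> w' s"
  shows "j \<le> j'"
  using assms(1)
proof (rule has_pos_integralE)
  fix \<phi> assume \<phi>: "\<And>n. \<phi> n \<in> unit_ideal_step M"
    and lim: "\<And>s. s \<in> space M \<Longrightarrow> increases_to (\<lambda>n. \<phi> n s) (w s)"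
    and j: "increases_to (\<lambda>n. I\<^sub>s (\<phi> n)) j"
  have "I\<^sub>s (\<phi> n) \<le> j'" for n
    by (rule step_integral_le_has_pos_integral[OF \<phi> assms(2)])
       (use increases_toD(2)[OF lim] assms(3) order_trans in blast)
  then show ?thesis by (rule increases_toD(3)[OF j])
qed

lemma has_pos_integral_nonneg: "has_pos_integral w j \<Longrightarrow> s \<in> space M \<Longrightarrow> 0 \<le> w s"
  unfolding has_pos_integral_def using increases_toD(2) order_trans unit_ideal_stepD(2) by metis

lemma has_pos_integral_integral_nonneg: "has_pos_integral w j \<Longrightarrow> 0 \<le> j"
  unfolding has_pos_integral_def using increases_toD(2) order_trans step_integral_nonneg by metis

lemma has_pos_integral_positive_measurable:
  assumes "has_pos_integral w j"
  shows "w \<in> positive_measurable M"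
proof -
  obtain \<phi> where "\<And>n. \<phi> n \<in> unit_ideal_step M"
    "\<And>s. s \<in> space M \<Longrightarrow> increases_to (\<lambda>n. \<phi> n s) (w s)" "increases_to (\<lambda>n. I\<^sub>s (\<phi> n)) j"
    by (fact has_pos_integralE[OF assms])
  then have "(\<forall>n. \<phi> n \<in> positive_step M) \<and> (\<forall>s\<in>space M. increases_to (\<lambda>n. \<phi> n s) (w s))"
    unfolding unit_ideal_step_def by auto
  then show ?thesis
    unfolding positive_measurable_def using has_pos_integral_nonneg[OF assms] by auto
qed

text \<open>Domination supplies the finite integral only. Membership in
  \<open>positive_measurable\<close> is a separate hypothesis, since in general it does not pass to
  smaller nonnegative functions.\<close>

lemma has_pos_integral_dominated:
  assumes "w \<in> positive_measurable M" "has_pos_integral w' j'" "\<And>s. s \<in> space M \<Longrightarrow> w s \<le> w' s"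
  shows "\<exists>j. has_pos_integral w j"
proof -
  obtain \<phi> where \<phi>: "\<And>n. \<phi> n \<in> unit_ideal_step M"
    and lim: "\<And>s. s \<in> space M \<Longrightarrow> increases_to (\<lambda>n. \<phi> n s) (w s)"
    using positive_measurable_unit_ideal_step[OF assms(1)] by blast
  have "I\<^sub>s (\<phi> n) \<le> j'" for n
    by (rule step_integral_le_has_pos_integral[OF \<phi> assms(2)])
       (use increases_toD(2)[OF lim] assms(3) order_trans in blast)
  from has_pos_integral_lim[OF \<phi> lim this] show ?thesis by blast
qed

lemma has_pos_integral_step:
  "\<phi> \<in> unit_ideal_step M \<Longrightarrow> has_pos_integral \<phi> (I\<^sub>s \<phi>)"
  unfolding has_pos_integral_def by (rule exI[of _ "\<lambda>n. \<phi>"]) (simp add: increases_to_const)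

lemma has_pos_integral_add:
  assumes "has_pos_integral u a" "has_pos_integral v b"
  shows "has_pos_integral (\<lambda>s. u s + v s) (a + b)"
proof -
  obtain \<phi> where \<phi>: "\<And>n. \<phi> n \<in> unit_ideal_step M"
    "\<And>s. s \<in> space M \<Longrightarrow> increases_to (\<lambda>n. \<phi> n s) (u s)" "increases_to (\<lambda>n. I\<^sub>s (\<phi> n)) a"
    by (fact has_pos_integralE[OF assms(1)])
  obtain \<psi> where \<psi>: "\<And>n. \<psi> n \<in> unit_ideal_step M"
    "\<And>s. s \<in> space M \<Longrightarrow> increases_to (\<lambda>n. \<psi> n s) (v s)" "increases_to (\<lambda>n. I\<^sub>s (\<psi> n)) b"
    by (fact has_pos_integralE[OF assms(2)])
  have eq: "I\<^sub>s (\<lambda>s. \<phi> n s + \<psi> n s) = I\<^sub>s (\<phi> n) + I\<^sub>s (\<psi> n)" for n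
    using \<phi>(1) \<psi>(1) by (intro step_integral_add unit_ideal_stepD)
  show ?thesis
    unfolding has_pos_integral_def
    by (rule exI[of _ "\<lambda>n s. \<phi> n s + \<psi> n s"])
       (simp add: eq unit_ideal_step_add \<phi> \<psi> increases_to_add)
qed

text \<open>The bound \<open>q \<le> 1\<close> keeps the approximating step functions in the unit
  ideal.\<close>

lemma has_pos_integral_mult_left:
  assumes "has_pos_integral u a" "0 \<le> q" "q \<le> 1"
  shows "has_pos_integral (\<lambda>s. q * u s) (q * a)"
proof -
  obtain \<phi> where \<phi>: "\<And>n. \<phi> n \<in> unit_ideal_step M"
    "\<And>s. s \<in> space M \<Longrightarrow> increases_to (\<lambda>n. \<phi> n s) (u s)" "increases_to (\<lambda>n. I\<^sub>s (\<phi> n)) a"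
    by (fact has_pos_integralE[OF assms(1)])
  have eq: "I\<^sub>s (\<lambda>s. q * \<phi> n s) = q * I\<^sub>s (\<phi> n)" for n
    using \<phi>(1) by (intro step_integral_mult_left unit_ideal_stepD)
  show ?thesis
    unfolding has_pos_integral_def
    by (rule exI[of _ "\<lambda>n s. q * \<phi> n s"])
       (simp add: eq unit_ideal_step_mult_left \<phi> increases_to_mult_left assms)
qed

lemma has_pos_integral_zero: "has_pos_integral (\<lambda>s. 0) 0"
proof -
  have "(\<lambda>s. 0) \<in> unit_ideal_step M"
    by (intro unit_ideal_stepI) (auto simp: unit_ideal_zero)
  moreover have "I\<^sub>s (\<lambda>s. 0) = 0"
    unfolding step_integral_def by (intro sum.neutral) auto
  ultimately show ?thesis using has_pos_integral_step by metis
qed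

lemma has_pos_integral_sum:
  "(\<And>k. has_pos_integral (u k) (a k)) \<Longrightarrow> has_pos_integral (\<lambda>s. \<Sum>k<n. u k s) (\<Sum>k<n. a k)" for n :: nat
  by (induction n) (simp_all add: has_pos_integral_zero has_pos_integral_add)

text \<open>Serves to cap a function \<open>v\<close> at a fixed majorant \<open>u\<close> without
  raising its integral, hence the bound by \<open>b\<close>.\<close>

lemma has_pos_integral_inf:
  assumes "has_pos_integral u a" "has_pos_integral v b"
  shows "\<exists>c\<le>b. has_pos_integral (\<lambda>s. inf (u s) (v s)) c"
proof -
  obtain \<phi> where \<phi>: "\<And>n. \<phi> n \<in> unit_ideal_step M"
    "\<And>s. s \<in> space M \<Longrightarrow> increases_to (\<lambda>n. \<phi> n s) (u s)" "increases_to (\<lambda>n. I\<^sub>s (\<phi> n)) a"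
    by (fact has_pos_integralE[OF assms(1)])
  obtain \<psi> where \<psi>: "\<And>n. \<psi> n \<in> unit_ideal_step M"
    "\<And>s. s \<in> space M \<Longrightarrow> increases_to (\<lambda>n. \<psi> n s) (v s)" "increases_to (\<lambda>n. I\<^sub>s (\<psi> n)) b"
    by (fact has_pos_integralE[OF assms(2)])
  have "\<exists>c\<le>b. has_pos_integral (\<lambda>s. inf (u s) (v s)) c \<and> increases_to (\<lambda>n. I\<^sub>s (\<lambda>s. inf (\<phi> n s) (\<psi> n s))) c"
  proof (rule has_pos_integral_lim)
    show step: "(\<lambda>s. inf (\<phi> n s) (\<psi> n s)) \<in> unit_ideal_step M" for n
      by (intro unit_ideal_step_inf \<phi> \<psi>)
    show "I\<^sub>s (\<lambda>s. inf (\<phi> n s) (\<psi> n s)) \<le> b" for n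
      by (rule order_trans[OF step_integral_mono increases_toD(2)[OF \<psi>(3), of n]])
         (use unit_ideal_stepD(1)[OF step] unit_ideal_stepD(1)[OF \<psi>(1)] in auto)
  qed (intro increases_to_inf \<phi> \<psi>)
  then show ?thesis by blast
qed

lemma has_pos_integral_sup:
  assumes "has_pos_integral u a" "has_pos_integral v b"
  shows "\<exists>c. has_pos_integral (\<lambda>s. sup (u s) (v s)) c"
proof -
  obtain \<phi> where \<phi>: "\<And>n. \<phi> n \<in> unit_ideal_step M"
    "\<And>s. s \<in> space M \<Longrightarrow> increases_to (\<lambda>n. \<phi> n s) (u s)" "increases_to (\<lambda>n. I\<^sub>s (\<phi> n)) a"
    by (fact has_pos_integralE[OF assms(1)])
  obtain \<psi> where \<psi>: "\<And>n. \<psi> n \<in> unit_ideal_step M"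
    "\<And>s. s \<in> space M \<Longrightarrow> increases_to (\<lambda>n. \<psi> n s) (v s)" "increases_to (\<lambda>n. I\<^sub>s (\<psi> n)) b"
    by (fact has_pos_integralE[OF assms(2)])
  have "\<exists>c\<le>a + b. has_pos_integral (\<lambda>s. sup (u s) (v s)) c \<and> increases_to (\<lambda>n. I\<^sub>s (\<lambda>s. sup (\<phi> n s) (\<psi> n s))) c"
  proof (rule has_pos_integral_lim)
    show step: "(\<lambda>s. sup (\<phi> n s) (\<psi> n s)) \<in> unit_ideal_step M" for n
      by (intro unit_ideal_step_sup \<phi> \<psi>)
    show "I\<^sub>s (\<lambda>s. sup (\<phi> n s) (\<psi> n s)) \<le> a + b" for n
    proof (rule step_integral_le_has_pos_integral[OF step has_pos_integral_add[OF assms]])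
      fix s assume s: "s \<in> space M"
      have "\<phi> n s \<le> u s" "\<psi> n s \<le> v s" "0 \<le> u s" "0 \<le> v s"
        using increases_toD(2)[OF \<phi>(2)[OF s]] increases_toD(2)[OF \<psi>(2)[OF s]]
          has_pos_integral_nonneg[OF assms(1) s] has_pos_integral_nonneg[OF assms(2) s] by auto
      then have "\<phi> n s \<le> u s + v s" "\<psi> n s \<le> u s + v s"
        by (simp_all add: add_increasing add_increasing2)
      then show "sup (\<phi> n s) (\<psi> n s) \<le> u s + v s" by (rule le_supI)
    qed
  qed (intro increases_to_sup \<phi> \<psi>)
  then show ?thesis by blast
qed

text \<open>Monotone convergence by a diagonal sequence. The step function \<open>\<xi> n n\<close>
  lies below \<open>w n\<close>, so its integral is at most \<open>j n\<close>, while every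
  \<open>\<phi> k m\<close> lies below a diagonal term.\<close>

lemma has_pos_integral_monotone_limit:
  assumes w: "\<And>k. has_pos_integral (w k) (j k)"
    and lim: "\<And>s. s \<in> space M \<Longrightarrow> increases_to (\<lambda>k. w k s) (W s)"
    and B: "\<And>k. j k \<le> B"
  shows "\<exists>J\<le>B. has_pos_integral W J"
proof -
  have "\<exists>\<phi>. (\<forall>n. \<phi> n \<in> unit_ideal_step M) \<and> (\<forall>s\<in>space M. increases_to (\<lambda>n. \<phi> n s) (w k s))" for k
    using w[of k] unfolding has_pos_integral_def by blast
  then obtain \<phi> where \<phi>: "\<And>k n. \<phi> k n \<in> unit_ideal_step M"
    and \<phi>lim: "\<And>k s. s \<in> space M \<Longrightarrow> increases_to (\<lambda>n. \<phi> k n s) (w k s)"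
    by metis
  define \<xi> where "\<xi> m n s = partial_sup (\<lambda>k. \<phi> k n s) m" for m n s
  have \<xi>0: "\<xi> 0 n = \<phi> 0 n" and \<xi>Suc: "\<xi> (Suc m) n s = sup (\<xi> m n s) (\<phi> (Suc m) n s)" for m n s
    by (simp_all add: \<xi>_def fun_eq_iff)
  have \<xi>: "\<xi> m n \<in> unit_ideal_step M" for m n
    by (induction m) (simp_all add: \<xi>0 \<phi> \<xi>Suc[abs_def] unit_ideal_step_sup)
  have ge: "\<phi> k n s \<le> \<xi> m n s" if "k \<le> m" for k m n s
    unfolding \<xi>_def using that by (rule partial_sup_upper)
  have le: "\<xi> m n s \<le> w m s" if s: "s \<in> space M" for m n s
  proof (induction m)
    case 0
    then show ?case using increases_toD(2)[OF \<phi>lim[OF s]] by (simp add: \<xi>0)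
  next
    case (Suc m)
    moreover have "w m s \<le> w (Suc m) s" by (rule increases_toD(1)[OF lim[OF s]]) simp
    ultimately show ?case using increases_toD(2)[OF \<phi>lim[OF s]] by (auto simp: \<xi>Suc intro: order_trans)
  qed
  have inc: "\<xi> m n s \<le> \<xi> m (Suc n) s" if s: "s \<in> space M" for m n s
  proof (induction m)
    case 0
    then show ?case using increases_toD(1)[OF \<phi>lim[OF s]] by (simp add: \<xi>0)
  next
    case (Suc m)
    then show ?case unfolding \<xi>Suc using increases_toD(1)[OF \<phi>lim[OF s]] by (intro sup_mono) auto
  qed
  have "\<exists>J\<le>B. has_pos_integral W J \<and> increases_to (\<lambda>n. I\<^sub>s (\<xi> n n)) J"
  proof (rule has_pos_integral_lim)
    fix s assume s: "s \<in> space M"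
    show "increases_to (\<lambda>n. \<xi> n n s) (W s)"
    proof (rule increases_toI)
      show "\<xi> n n s \<le> \<xi> (Suc n) (Suc n) s" for n
        unfolding \<xi>Suc by (intro le_supI1 inc s)
      show "\<xi> n n s \<le> W s" for n
        using le[OF s] increases_toD(2)[OF lim[OF s]] by (rule order_trans)
      fix y assume y: "\<And>n. \<xi> n n s \<le> y"
      have "\<phi> k n s \<le> y" for k n
      proof -
        have "\<phi> k n s \<le> \<phi> k (max k n) s" by (rule increases_toD(1)[OF \<phi>lim[OF s]]) simp
        also have "\<dots> \<le> \<xi> (max k n) (max k n) s" by (rule ge) simp
        also have "\<dots> \<le> y" by (rule y)
        finally show ?thesis .
      qed
      then have "w k s \<le> y" for k by (rule increases_toD(3)[OF \<phi>lim[OF s]])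
      then show "W s \<le> y" by (rule increases_toD(3)[OF lim[OF s]])
    qed
  next
    show "I\<^sub>s (\<xi> n n) \<le> B" for n
      using step_integral_le_has_pos_integral[OF \<xi> w le] B by (rule order_trans)
  qed (rule \<xi>)
  then show ?thesis by blast
qed

subsection \<open>Bounds for the outer integral\<close>

text \<open>That \<open>b\<close> bounds the outer integral of \<open>h\<close> is meant in a strong sense: a single majorant comes within
  \<open>e \<cdot> 1\<close> of it. The infimum of the integrals of all majorants need not have this property.\<close>

definition outer_integral_le :: "('s \<Rightarrow> 'l) \<Rightarrow> 'l \<Rightarrow> bool" where
  "outer_integral_le h b \<longleftrightarrow>
     (\<forall>e>0. \<exists>w j. has_pos_integral w j \<and> (\<forall>s\<in>space M. h s \<le> w s) \<and> j \<le> b + e *\<^sub>R 1)"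

lemma outer_integral_leE:
  assumes "outer_integral_le h b" "0 < e"
  obtains w j where "has_pos_integral w j" "\<And>s. s \<in> space M \<Longrightarrow> h s \<le> w s" "j \<le> b + e *\<^sub>R 1"
  using assms unfolding outer_integral_le_def by blast

lemma outer_integral_le_mono:
  assumes "outer_integral_le h b" "\<And>s. s \<in> space M \<Longrightarrow> h' s \<le> h s"
  shows "outer_integral_le h' b"
  using assms unfolding outer_integral_le_def by (meson order_trans)

lemma outer_integral_le_has_pos_integral:
  assumes "has_pos_integral w j"
  shows "outer_integral_le w j"
proof -
  have "j \<le> j + e *\<^sub>R 1" if "0 < e" for e :: real
    using scaleR_nonneg_nonneg[OF less_imp_le[OF that] f_algebra_one_nonneg] by (simp only: le_add_same_cancel1)
  then show ?thesis unfolding outer_integral_le_def using assms by blast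
qed

text \<open>Half of the error is spent on the bound and half on the majorant. In this way a
  construction may work with a fixed \<open>e\<close> throughout.\<close>

lemma outer_integral_le_closed:
  assumes "\<And>e. 0 < e \<Longrightarrow> outer_integral_le h (b + e *\<^sub>R 1)"
  shows "outer_integral_le h b"
  unfolding outer_integral_le_def
proof (intro allI impI)
  fix e :: real assume "0 < e"
  then obtain w j where "has_pos_integral w j" "\<And>s. s \<in> space M \<Longrightarrow> h s \<le> w s"
    "j \<le> b + (e/2) *\<^sub>R 1 + (e/2) *\<^sub>R 1"
    using outer_integral_leE[OF assms[of "e/2"], of "e/2"] by auto
  moreover have "b + (e/2) *\<^sub>R 1 + (e/2) *\<^sub>R 1 = b + e *\<^sub>R 1"
    by (simp add: add.assoc flip: scaleR_add_left)
  ultimately show "\<exists>w j. has_pos_integral w j \<and> (\<forall>s\<in>space M. h s \<le> w s) \<and> j \<le> b + e *\<^sub>R 1"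
    by auto
qed

text \<open>Countable subadditivity. Majorants of the terms with errors \<open>e / 2 ^ Suc k\<close>
  have integrals whose partial sums stay below \<open>B + e *\<^sub>R 1\<close>, and monotone
  convergence applies to their sums.\<close>

lemma outer_integral_le_sums:
  assumes h: "\<And>k. outer_integral_le (h k) (b k)"
    and x: "\<And>s. s \<in> space M \<Longrightarrow> increases_to (\<lambda>n. \<Sum>k<n. h k s) (x s)"
    and u: "has_pos_integral u c" "\<And>s. s \<in> space M \<Longrightarrow> x s \<le> u s"
    and B: "\<And>n. (\<Sum>k<n. b k) \<le> B"
  shows "outer_integral_le x B"
  unfolding outer_integral_le_def
proof (intro allI impI)
  fix e :: real assume e: "0 < e"
  have "\<exists>w j. has_pos_integral w j \<and> (\<forall>s\<in>space M. h k s \<le> w s) \<and> j \<le> b k + (e / 2 ^ Suc k) *\<^sub>R 1" for k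
    using h[of k] e unfolding outer_integral_le_def by simp
  then obtain w j where w: "\<And>k. has_pos_integral (w k) (j k)"
    and hw: "\<And>k s. s \<in> space M \<Longrightarrow> h k s \<le> w k s"
    and j: "\<And>k. j k \<le> b k + (e / 2 ^ Suc k) *\<^sub>R 1"
    by metis
  have jsum: "(\<Sum>k<n. j k) \<le> B + e *\<^sub>R 1" for n
  proof -
    have geom: "(\<Sum>k<n. e / 2 ^ Suc k) \<le> e"
    proof -
      have "(\<Sum>k<n. e / 2 ^ Suc k) = e - e / 2 ^ n"
        by (induction n) (auto simp: field_simps)
      then show ?thesis using e by simp
    qed
    have "(\<Sum>k<n. j k) \<le> (\<Sum>k<n. b k + (e / 2 ^ Suc k) *\<^sub>R 1)"
      by (intro sum_mono j)
    also have "\<dots> = (\<Sum>k<n. b k) + (\<Sum>k<n. e / 2 ^ Suc k) *\<^sub>R 1"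
      by (simp add: sum.distrib scaleR_sum_left)
    also have "\<dots> \<le> B + e *\<^sub>R 1"
      by (intro add_mono B scaleR_right_mono geom f_algebra_one_nonneg)
    finally show ?thesis .
  qed
  have "\<exists>c\<le>(\<Sum>k<n. j k). has_pos_integral (\<lambda>s. inf (u s) (\<Sum>k<n. w k s)) c" for n
    by (rule has_pos_integral_inf[OF u(1) has_pos_integral_sum[OF w]])
  then obtain J where J: "\<And>n. has_pos_integral (\<lambda>s. inf (u s) (\<Sum>k<n. w k s)) (J n)"
    and Jle: "\<And>n. J n \<le> (\<Sum>k<n. j k)"
    by metis
  define W where "W s = Sup (range (\<lambda>n. inf (u s) (\<Sum>k<n. w k s)))" for s
  have W: "increases_to (\<lambda>n. inf (u s) (\<Sum>k<n. w k s)) (W s)" if s: "s \<in> space M" for s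
    unfolding W_def
  proof (rule increases_to_Sup)
    show "inf (u s) (\<Sum>k<n. w k s) \<le> inf (u s) (\<Sum>k<Suc n. w k s)" for n
      using has_pos_integral_nonneg[OF w s] by (intro inf_mono) auto
    show "inf (u s) (\<Sum>k<n. w k s) \<le> u s" for n by simp
  qed
  have "\<exists>J\<le>B + e *\<^sub>R 1. has_pos_integral W J"
    by (rule has_pos_integral_monotone_limit[OF J W]) (auto intro: order_trans[OF Jle jsum])
  moreover have "x s \<le> W s" if s: "s \<in> space M" for s
  proof (rule increases_toD(3)[OF x[OF s]])
    fix n
    have "(\<Sum>k<n. h k s) \<le> u s"
      using increases_toD(2)[OF x[OF s]] u(2)[OF s] by (rule order_trans)
    then have "(\<Sum>k<n. h k s) \<le> inf (u s) (\<Sum>k<n. w k s)"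
      using hw[OF s] by (simp add: sum_mono)
    also have "\<dots> \<le> W s" by (rule increases_toD(2)[OF W[OF s]])
    finally show "(\<Sum>k<n. h k s) \<le> W s" .
  qed
  ultimately show "\<exists>w j. has_pos_integral w j \<and> (\<forall>s\<in>space M. x s \<le> w s) \<and> j \<le> B + e *\<^sub>R 1"
    by blast
qed

lemma outer_integral_le_nonneg:
  assumes "outer_integral_le h b"
  shows "0 \<le> b"
proof (rule le_if_le_add_unit)
  fix e :: real assume "0 < e"
  with assms obtain w j where "has_pos_integral w j" "j \<le> b + e *\<^sub>R 1"
    by (rule outer_integral_leE)
  then show "0 \<le> b + e *\<^sub>R 1" using has_pos_integral_integral_nonneg order_trans by blast
qed

text \<open>In \<open>\<bbbL>\<close>, a sequence decreasing to \<open>\<beta>\<close> need not come within \<open>e \<cdot> 1\<close> of it. Linearity over \<open>\<bbbL>\<close>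
  makes up for this: write \<open>x\<close> as an order convergent sum \<open>\<Sum>\<^sub>n q\<^sub>n x\<close>, where \<open>\<Sum>\<^sub>n q\<^sub>n = 1\<close> and the \<open>n\<close>-th bound
  is \<open>e\<close>-close to \<open>\<beta>\<close> on \<open>q\<^sub>n\<close>. The partial sums of such \<open>q\<^sub>n\<close> are \<open>(1 - (b\<^sub>n - \<beta>)/e)\<^sup>+\<close>, since this is
  disjoint from \<open>(1 - (b\<^sub>n - \<beta>)/e)\<^sup>-\<close>.\<close>

lemma outer_integral_le_decreasing:
  assumes h: "\<And>n. outer_integral_le x (b n)" and b: "decreases_to b \<beta>"
    and x: "\<And>s. s \<in> space M \<Longrightarrow> 0 \<le> x s"
  shows "outer_integral_le x \<beta>"
proof (rule outer_integral_le_closed)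
  fix e :: real assume e: "0 < e"
  have \<beta>: "0 \<le> \<beta>" by (rule decreases_toD(3)[OF b outer_integral_le_nonneg[OF h]])
  \<comment> \<open>The bound \<open>b n\<close> is within \<open>e *\<^sub>R 1\<close> of
    \<open>\<beta>\<close> where \<open>t n\<close> is nonnegative. In the next definition the index
    is shifted, so that \<open>p (Suc n)\<close> belongs to \<open>b n\<close>, and the prepended
    \<open>0\<close> makes the sum of the first \<open>n\<close> terms of \<open>q\<close> equal to
    \<open>p n\<close>.\<close>
  define t where "t n = 1 - (1 / e) *\<^sub>R (b n - \<beta>)" for n
  define p where "p = case_nat 0 (\<lambda>n. pprt (t n))"
  define q where "q n = p (Suc n) - p n" for n
  have t_mono: "t n \<le> t (Suc n)" for n
    unfolding t_def using e decreases_toD(1)[OF b, of n "Suc n"]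
    by (intro diff_left_mono scaleR_left_mono diff_right_mono) auto
  have p_nonneg: "0 \<le> p n" for n
    by (auto simp: p_def split: nat.split)
  have p_mono: "p n \<le> p (Suc n)" for n
  proof (cases n)
    case (Suc m)
    have "sup (t m) 0 \<le> sup (t n) 0" using t_mono[of m] Suc by (intro sup_mono) auto
    then show ?thesis by (simp add: p_def pprt_def Suc)
  qed (simp add: p_def)
  have p_le1: "p n \<le> 1" for n
  proof (cases n)
    case (Suc m)
    have "0 \<le> (1 / e) *\<^sub>R (b m - \<beta>)"
      using e decreases_toD(2)[OF b, of m] by (intro scaleR_nonneg_nonneg) auto
    then have "t m \<le> 1" by (simp add: t_def)
    then show ?thesis using f_algebra_one_nonneg by (simp add: p_def pprt_def Suc)
  qed (simp add: p_def f_algebra_one_nonneg)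
  have p_lim: "decreases_to (\<lambda>n. 1 - p n) 0"
  proof (rule decreases_toI)
    fix y assume y: "\<And>n. y \<le> 1 - p n"
    have "e *\<^sub>R y \<le> b n - \<beta>" for n
    proof -
      have "t n \<le> p (Suc n)" by (simp add: p_def pprt_def)
      then have "1 - p (Suc n) \<le> 1 - t n" by (rule diff_left_mono)
      with y[of "Suc n"] have "y \<le> 1 - t n" by (rule order_trans)
      then have "e *\<^sub>R y \<le> e *\<^sub>R (1 - t n)" using e by (intro scaleR_left_mono) auto
      then show ?thesis using e by (simp add: t_def)
    qed
    then have "e *\<^sub>R y + \<beta> \<le> b n" for n by (simp add: le_diff_eq)
    from decreases_toD(3)[OF b this] have "e *\<^sub>R y \<le> 0" by simp
    then have "(1 / e) *\<^sub>R (e *\<^sub>R y) \<le> (1 / e) *\<^sub>R 0" using e by (intro scaleR_left_mono) auto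
    then show "y \<le> 0" using e by simp
  qed (use p_mono p_le1 in \<open>auto simp: diff_left_mono\<close>)
  have q_nonneg: "0 \<le> q n" for n using p_mono by (simp add: q_def)
  have q_le: "q n \<le> p (Suc n)" for n using p_nonneg[of n] by (simp add: q_def)
  have q_le1: "q n \<le> 1" for n using q_le p_le1 by (rule order_trans)
  \<comment> \<open>Since \<open>q n\<close> lies below \<open>pprt (t n)\<close>, it annihilates
    \<open>pprt (- t n)\<close>. Thus \<open>q n * (- t n) \<le> 0\<close>, which is the claim up to
    the factor \<open>e\<close>.\<close>
  have qb: "q n * b n \<le> q n * (\<beta> + e *\<^sub>R 1)" for n
  proof -
    have "q n * (- t n) \<le> q n * pprt (- t n)"
      by (intro mult_left_mono q_nonneg) (simp add: pprt_def)
    also have "\<dots> \<le> p (Suc n) * pprt (- t n)"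
      by (intro mult_right_mono q_le) simp
    also have "\<dots> = 0" by (simp add: p_def pprt_mult_pprt_minus)
    finally have "e *\<^sub>R (q n * (- t n)) \<le> e *\<^sub>R 0"
      using e by (intro scaleR_left_mono) auto
    moreover have "e *\<^sub>R (q n * (- t n)) = q n * b n - q n * (\<beta> + e *\<^sub>R 1)"
      using e by (simp add: t_def algebra_simps)
    ultimately have "q n * b n - q n * (\<beta> + e *\<^sub>R 1) \<le> 0"
      by (simp only: scaleR_zero_right)
    then show ?thesis by (simp only: diff_le_0_iff_le)
  qed
  \<comment> \<open>Linearity over \<open>'l\<close>: a majorant of \<open>x\<close> that is good
    for \<open>b n\<close> is multiplied by \<open>q n\<close>, and its error
    \<open>d *\<^sub>R q n\<close> is at most \<open>d *\<^sub>R 1\<close>.\<close>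
  have part: "outer_integral_le (\<lambda>s. q n * x s) (q n * (\<beta> + e *\<^sub>R 1))" for n
    unfolding outer_integral_le_def
  proof (intro allI impI)
    fix d :: real assume d: "0 < d"
    obtain w j where w: "has_pos_integral w j" "\<And>s. s \<in> space M \<Longrightarrow> x s \<le> w s" "j \<le> b n + d *\<^sub>R 1"
      using outer_integral_leE[OF h d] by metis
    have "q n * j \<le> q n * (b n + d *\<^sub>R 1)" by (intro mult_left_mono w q_nonneg)
    also have "\<dots> = q n * b n + d *\<^sub>R q n" by (simp add: distrib_left)
    also have "\<dots> \<le> q n * (\<beta> + e *\<^sub>R 1) + d *\<^sub>R 1"
      using d by (intro add_mono qb scaleR_left_mono q_le1) auto
    finally show "\<exists>w j. has_pos_integral w j \<and> (\<forall>s\<in>space M. q n * x s \<le> w s)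
        \<and> j \<le> q n * (\<beta> + e *\<^sub>R 1) + d *\<^sub>R 1"
      using has_pos_integral_mult_left[OF w(1) q_nonneg q_le1, of n] w(2) q_nonneg
      by (blast intro: mult_left_mono)
  qed
  have qsum: "(\<Sum>k<n. q k * y) = p n * y" for n y
  proof -
    have "(\<Sum>k<n. q k) = p n"
      unfolding q_def sum_lessThan_telescope by (simp add: p_def)
    then show ?thesis by (simp flip: sum_distrib_right)
  qed
  \<comment> \<open>Any majorant with finite integral will do here; it is the cap required by
    \<open>outer_integral_le_sums\<close>.\<close>
  obtain w j where w: "has_pos_integral w j" "\<And>s. s \<in> space M \<Longrightarrow> x s \<le> w s"
    using outer_integral_leE[OF h[of 0] zero_less_one] by metis
  show "outer_integral_le x (\<beta> + e *\<^sub>R 1)"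
  proof (rule outer_integral_le_sums[OF part _ w])
    fix s assume s: "s \<in> space M"
    have "increases_to (\<lambda>n. p n * x s) (x s)"
    proof (rule increases_to_squeeze)
      show "decreases_to (\<lambda>n. (1 - p n) * x s) 0"
        using p_nonneg by (intro decreases_to_mult_right p_lim x s) simp
      show "x s - p n * x s \<le> (1 - p n) * x s" for n
        by (simp add: left_diff_distrib)
      show "p n * x s \<le> p (Suc n) * x s" for n
        by (intro mult_right_mono p_mono x s)
      show "p n * x s \<le> x s" for n
        using mult_right_mono[OF p_le1 x[OF s], of n] by simp
    qed
    then show "increases_to (\<lambda>n. \<Sum>k<n. q k * x s) (x s)" by (simp add: qsum)
  next
    have "0 \<le> \<beta> + e *\<^sub>R 1" using \<beta> e by (intro add_nonneg_nonneg scaleR_nonneg_nonneg f_algebra_one_nonneg) auto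
    then show "(\<Sum>k<n. q k * (\<beta> + e *\<^sub>R 1)) \<le> \<beta> + e *\<^sub>R 1" for n
      using mult_right_mono[OF p_le1, of "\<beta> + e *\<^sub>R 1" n] unfolding qsum by simp
  qed
qed

subsection \<open>Differences of functions with finite integral\<close>

definition has_diff_integral :: "('s \<Rightarrow> 'l) \<Rightarrow> 'l \<Rightarrow> bool" where
  "has_diff_integral h a \<longleftrightarrow> (\<exists>u v b c. has_pos_integral u b \<and> has_pos_integral v c \<and>
     (\<forall>s\<in>space M. h s = u s - v s) \<and> a = b - c)"

lemma has_diff_integralE:
  assumes "has_diff_integral h a"
  obtains u v b c where "has_pos_integral u b" "has_pos_integral v c"
    "\<And>s. s \<in> space M \<Longrightarrow> h s = u s - v s" "a = b - c"
  using assms unfolding has_diff_integral_def by blast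

lemma has_diff_integralI:
  "has_pos_integral u b \<Longrightarrow> has_pos_integral v c \<Longrightarrow> has_diff_integral (\<lambda>s. u s - v s) (b - c)"
  unfolding has_diff_integral_def by blast

lemma has_diff_integral_cong:
  "has_diff_integral h a \<Longrightarrow> (\<And>s. s \<in> space M \<Longrightarrow> h s = h' s) \<Longrightarrow> has_diff_integral h' a"
  unfolding has_diff_integral_def by force

lemma has_diff_integral_has_pos_integral: "has_pos_integral u b \<Longrightarrow> has_diff_integral u b"
  using has_diff_integralI[OF _ has_pos_integral_zero] by simp

text \<open>Adding both subtracted functions turns the hypothesis into
  \<open>u + v' \<le> u' + v\<close> between functions with a positive integral. The case of
  equality shows that the integral does not depend on the decomposition.\<close>

lemma has_diff_integral_mono:
  assumes "has_diff_integral h a" "has_diff_integral h' a'" "\<And>s. s \<in> space M \<Longrightarrow> h s \<le> h' s"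
  shows "a \<le> a'"
proof -
  obtain u v b c where 1: "has_pos_integral u b" "has_pos_integral v c"
    "\<And>s. s \<in> space M \<Longrightarrow> h s = u s - v s" "a = b - c"
    using has_diff_integralE[OF assms(1)] by metis
  obtain u' v' b' c' where 2: "has_pos_integral u' b'" "has_pos_integral v' c'"
    "\<And>s. s \<in> space M \<Longrightarrow> h' s = u' s - v' s" "a' = b' - c'"
    using has_diff_integralE[OF assms(2)] by metis
  have "b + c' \<le> b' + c"
  proof (rule has_pos_integral_mono[OF has_pos_integral_add[OF 1(1) 2(2)] has_pos_integral_add[OF 2(1) 1(2)]])
    fix s assume s: "s \<in> space M"
    show "u s + v' s \<le> u' s + v s"
      using assms(3)[OF s] unfolding 1(3)[OF s] 2(3)[OF s] by (simp add: algebra_simps)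
  qed
  then show ?thesis unfolding 1(4) 2(4) by (simp add: algebra_simps)
qed

lemma has_diff_integral_unique:
  assumes "has_diff_integral h a" "has_diff_integral h a'"
  shows "a = a'"
  using has_diff_integral_mono[OF assms] has_diff_integral_mono[OF assms(2,1)] by (simp add: order_antisym)

lemma has_diff_integral_diff:
  assumes "has_diff_integral h a" "has_diff_integral h' a'"
  shows "has_diff_integral (\<lambda>s. h s - h' s) (a - a')"
proof -
  obtain u v b c where 1: "has_pos_integral u b" "has_pos_integral v c"
    "\<And>s. s \<in> space M \<Longrightarrow> h s = u s - v s" "a = b - c"
    using has_diff_integralE[OF assms(1)] by metis
  obtain u' v' b' c' where 2: "has_pos_integral u' b'" "has_pos_integral v' c'"
    "\<And>s. s \<in> space M \<Longrightarrow> h' s = u' s - v' s" "a' = b' - c'"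
    using has_diff_integralE[OF assms(2)] by metis
  have "has_diff_integral (\<lambda>s. (u s + v' s) - (u' s + v s)) ((b + c') - (b' + c))"
    by (intro has_diff_integralI has_pos_integral_add 1 2)
  then have "has_diff_integral (\<lambda>s. h s - h' s) ((b + c') - (b' + c))"
    by (rule has_diff_integral_cong) (simp add: 1(3) 2(3) algebra_simps)
  then show ?thesis unfolding 1(4) 2(4) by (simp add: algebra_simps)
qed

text \<open>The supremum of \<open>u - v\<close> and \<open>u' - v'\<close> is the supremum of
  \<open>u + v'\<close> and \<open>u' + v\<close>, minus \<open>v + v'\<close>.\<close>

lemma has_diff_integral_sup:
  assumes "has_diff_integral h a" "has_diff_integral h' a'"
  shows "\<exists>d. has_diff_integral (\<lambda>s. sup (h s) (h' s)) d"
proof -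
  obtain u v b c where 1: "has_pos_integral u b" "has_pos_integral v c"
    "\<And>s. s \<in> space M \<Longrightarrow> h s = u s - v s" "a = b - c"
    using has_diff_integralE[OF assms(1)] by metis
  obtain u' v' b' c' where 2: "has_pos_integral u' b'" "has_pos_integral v' c'"
    "\<And>s. s \<in> space M \<Longrightarrow> h' s = u' s - v' s" "a' = b' - c'"
    using has_diff_integralE[OF assms(2)] by metis
  obtain d where d: "has_pos_integral (\<lambda>s. sup (u s + v' s) (u' s + v s)) d"
    using has_pos_integral_sup[OF has_pos_integral_add[OF 1(1) 2(2)] has_pos_integral_add[OF 2(1) 1(2)]] by blast
  have "has_diff_integral (\<lambda>s. sup (u s + v' s) (u' s + v s) - (v s + v' s)) (d - (c + c'))"
    by (intro has_diff_integralI has_pos_integral_add 1 2 d)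
  moreover have "sup (u s + v' s) (u' s + v s) - (v s + v' s) = sup (h s) (h' s)" if s: "s \<in> space M" for s
  proof -
    have "sup (u s + v' s) (u' s + v s) - (v s + v' s)
        = sup (u s + v' s - (v s + v' s)) (u' s + v s - (v s + v' s))"
      by (simp only: diff_conv_add_uminus add_sup_distrib_right)
    also have "u s + v' s - (v s + v' s) = h s" using 1(3)[OF s] by simp
    also have "u' s + v s - (v s + v' s) = h' s" using 2(3)[OF s] by simp
    finally show ?thesis .
  qed
  ultimately have "has_diff_integral (\<lambda>s. sup (h s) (h' s)) (d - (c + c'))"
    by (rule has_diff_integral_cong)
  then show ?thesis by blast
qed

lemma has_diff_integral_partial_sup:
  assumes "\<And>k. has_diff_integral (h k) (a k)"
  shows "\<exists>d. has_diff_integral (\<lambda>s. partial_sup (\<lambda>k. h k s) n) d"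
proof (induction n)
  case 0
  show ?case using assms[of 0] by auto
next
  case (Suc n)
  then show ?case using has_diff_integral_sup[OF _ assms] by auto
qed

lemma has_diff_integral_le_outer:
  assumes h: "has_diff_integral h a" and outer: "outer_integral_le h b"
  shows "a \<le> b"
proof (rule le_if_le_add_unit)
  fix e :: real assume e: "0 < e"
  obtain w j where w: "has_pos_integral w j" "\<And>s. s \<in> space M \<Longrightarrow> h s \<le> w s" "j \<le> b + e *\<^sub>R 1"
    using outer_integral_leE[OF outer e] by metis
  have "a \<le> j"
    by (rule has_diff_integral_mono[OF h has_diff_integral_has_pos_integral[OF w(1)] w(2)])
  then show "a \<le> b + e *\<^sub>R 1" using w(3) by (rule order_trans)
qed

text \<open>With steps \<open>\<phi> m\<close> increasing to \<open>v\<close>, the majorants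
  \<open>u - \<phi> m\<close> of \<open>u - v\<close> have integrals decreasing to
  \<open>b - c\<close>. They need not come within \<open>e *\<^sub>R 1\<close> of it, so
  \<open>outer_integral_le_decreasing\<close> is essential.\<close>

lemma outer_integral_le_has_diff_integral:
  assumes h: "has_diff_integral h a" and nonneg: "\<And>s. s \<in> space M \<Longrightarrow> 0 \<le> h s"
  shows "outer_integral_le h a"
proof -
  obtain u v b c where u: "has_pos_integral u b" and v: "has_pos_integral v c"
    and eq: "\<And>s. s \<in> space M \<Longrightarrow> h s = u s - v s" and a: "a = b - c"
    using has_diff_integralE[OF h] by metis
  obtain \<phi> where \<phi>: "\<And>n. \<phi> n \<in> unit_ideal_step M"
    "\<And>s. s \<in> space M \<Longrightarrow> increases_to (\<lambda>n. \<phi> n s) (v s)" "increases_to (\<lambda>n. I\<^sub>s (\<phi> n)) c"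
    by (fact has_pos_integralE[OF v])
  obtain \<psi> where \<psi>: "\<And>n. \<psi> n \<in> unit_ideal_step M"
    "\<And>s. s \<in> space M \<Longrightarrow> increases_to (\<lambda>n. \<psi> n s) (u s)" "increases_to (\<lambda>n. I\<^sub>s (\<psi> n)) b"
    by (fact has_pos_integralE[OF u])
  have le: "\<phi> m s \<le> v s" "v s \<le> u s" if s: "s \<in> space M" for m s
    using increases_toD(2)[OF \<phi>(2)[OF s]] nonneg[OF s] eq[OF s] by auto
  have "outer_integral_le h (b - I\<^sub>s (\<phi> m))" for m
  proof -
    \<comment> \<open>Unlike \<open>v\<close>, a step function can be subtracted inside
      \<open>positive_measurable\<close>: the positive parts of \<open>\<psi> k - \<phi> m\<close>
      are steps increasing to \<open>u - \<phi> m\<close>.\<close>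
    let ?d = "\<lambda>k s. sup (\<psi> k s + - \<phi> m s) 0"
    have "\<exists>j\<le>b. has_pos_integral (\<lambda>s. u s - \<phi> m s) j \<and> increases_to (\<lambda>k. I\<^sub>s (?d k)) j"
    proof (rule has_pos_integral_lim)
      show step: "?d k \<in> unit_ideal_step M" for k
      proof (rule unit_ideal_step_solid[OF \<psi>(1)[of k]])
        show "simple_function M (?d k)"
          by (rule simple_function_compose2[OF unit_ideal_stepD(1)[OF \<psi>(1)] unit_ideal_stepD(1)[OF \<phi>(1)]])
      qed (simp add: unit_ideal_stepD(2)[OF \<psi>(1)] unit_ideal_stepD(2)[OF \<phi>(1)])
      show "increases_to (\<lambda>k. ?d k s) (u s - \<phi> m s)" if s: "s \<in> space M" for s
      proof -
        have "increases_to (\<lambda>k. ?d k s) (sup (u s + - \<phi> m s) 0)"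
          by (intro increases_to_sup increases_to_add increases_to_const \<psi>(2) s)
        moreover have "0 \<le> u s - \<phi> m s" using order_trans[OF le[OF s]] by simp
        ultimately show ?thesis by (simp add: sup_absorb1)
      qed
      show "I\<^sub>s (?d k) \<le> b" for k
      proof (rule order_trans[OF step_integral_mono increases_toD(2)[OF \<psi>(3), of k]])
        show "?d k s \<le> \<psi> k s" if s: "s \<in> space M" for s
          using s by (simp add: unit_ideal_stepD(2)[OF \<psi>(1)] unit_ideal_stepD(2)[OF \<phi>(1)])
      qed (rule unit_ideal_stepD(1)[OF step] unit_ideal_stepD(1)[OF \<psi>(1)])+
    qed
    then obtain j where j: "has_pos_integral (\<lambda>s. u s - \<phi> m s) j" by blast
    \<comment> \<open>The value of \<open>j\<close> is identified by adding \<open>\<phi> m\<close>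
      back and comparing with the integral of \<open>u\<close>.\<close>
    have "has_pos_integral (\<lambda>s. u s - \<phi> m s + \<phi> m s) (j + I\<^sub>s (\<phi> m))"
      by (intro has_pos_integral_add j has_pos_integral_step \<phi>(1))
    then have "has_diff_integral u (j + I\<^sub>s (\<phi> m))"
      by (simp add: has_diff_integral_has_pos_integral)
    then have "j + I\<^sub>s (\<phi> m) = b"
      by (rule has_diff_integral_unique[OF _ has_diff_integral_has_pos_integral[OF u]])
    then have "j = b - I\<^sub>s (\<phi> m)" by (simp add: eq_diff_eq)
    then have "outer_integral_le (\<lambda>s. u s - \<phi> m s) (b - I\<^sub>s (\<phi> m))"
      using outer_integral_le_has_pos_integral[OF j] by simp
    then show ?thesis
      by (rule outer_integral_le_mono) (simp add: eq diff_left_mono le)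
  qed
  then show ?thesis
    unfolding a using decreases_to_diff_const_left[OF \<phi>(3), of b] nonneg
    by (rule outer_integral_le_decreasing)
qed

text \<open>The limit \<open>y\<close> may leave the class of differences, but the increments of the
  sequence are nonnegative differences, and \<open>outer_integral_le_sums\<close> adds them up. The
  prepended \<open>0\<close> makes \<open>x 0\<close> itself the first increment.\<close>

lemma outer_integral_le_increasing:
  assumes x: "\<And>k. has_diff_integral (x k) (c k)" and nonneg: "\<And>s. s \<in> space M \<Longrightarrow> 0 \<le> x 0 s"
    and lim: "\<And>s. s \<in> space M \<Longrightarrow> increases_to (\<lambda>k. x k s) (y s)"
    and u: "has_pos_integral u U" "\<And>s. s \<in> space M \<Longrightarrow> y s \<le> u s"
    and B: "\<And>k. c k \<le> B"
  shows "outer_integral_le y B"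
proof -
  let ?x = "case_nat (\<lambda>s. 0) x" and ?c = "case_nat 0 c"
  have x': "has_diff_integral (?x k) (?c k)" for k
    using x has_diff_integral_has_pos_integral[OF has_pos_integral_zero] by (cases k) auto
  have lim': "increases_to (\<lambda>k. ?x k s) (y s)" if s: "s \<in> space M" for s
  proof -
    have "(\<lambda>k. ?x k s) = case_nat 0 (\<lambda>k. x k s)" by (auto split: nat.split)
    then show ?thesis using increases_to_case_nat[OF lim[OF s] nonneg[OF s]] by simp
  qed
  have "0 \<le> c 0"
    using has_diff_integral_mono[OF x'[of 0] x[of 0]] nonneg by simp
  then have "0 \<le> B" using B[of 0] by (rule order_trans)
  then have c': "?c k \<le> B" for k using B by (cases k) auto
  show ?thesis
  proof (rule outer_integral_le_sums[where h="\<lambda>k s. ?x (Suc k) s - ?x k s" and b="\<lambda>k. ?c (Suc k) - ?c k", OF _ _ u])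
    fix k
    show "outer_integral_le (\<lambda>s. ?x (Suc k) s - ?x k s) (?c (Suc k) - ?c k)"
      using increases_toD(1)[OF lim', of _ k "Suc k"]
      by (intro outer_integral_le_has_diff_integral has_diff_integral_diff x') simp
  next
    fix s assume "s \<in> space M"
    have "(\<Sum>k<n. ?x (Suc k) s - ?x k s) = ?x n s" for n
      using sum_lessThan_telescope[of "\<lambda>k. ?x k s" n] by simp
    then show "increases_to (\<lambda>n. \<Sum>k<n. ?x (Suc k) s - ?x k s) (y s)"
      using lim'[OF \<open>s \<in> space M\<close>] by simp
  next
    show "(\<Sum>k<n. ?c (Suc k) - ?c k) \<le> B" for n
      using sum_lessThan_telescope[of ?c n] c'[of n] by simp
  qed
qed

lemma dominated_null_sequence:
  assumes h: "\<And>k. has_diff_integral (h k) (a k)"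
    and nonneg: "\<And>k s. s \<in> space M \<Longrightarrow> 0 \<le> h k s"
    and u: "has_pos_integral u U" "\<And>k s. s \<in> space M \<Longrightarrow> h k s \<le> u s"
    and H: "\<And>n s. s \<in> space M \<Longrightarrow> isLub UNIV ((\<lambda>k. h k s) ` {n..}) (H n s)"
    and null: "\<And>s. s \<in> space M \<Longrightarrow> decreases_to (\<lambda>n. H n s) 0"
  shows "\<exists>A. decreases_to A 0 \<and> (\<forall>n k. n \<le> k \<longrightarrow> a k \<le> A n)"
proof -
  \<comment> \<open>These approximate \<open>H n\<close> from below and, being finite suprema, stay
    in the class of differences.\<close>
  define F where "F n N s = partial_sup (\<lambda>k. h (n + k) s) N" for n N s
  have "\<exists>d. has_diff_integral (F n N) d" for n N
    unfolding F_def by (rule has_diff_integral_partial_sup) (rule h)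
  then obtain \<alpha> where \<alpha>: "\<And>n N. has_diff_integral (F n N) (\<alpha> n N)" by metis
  have Hu: "H n s \<le> u s" if s: "s \<in> space M" for n s
    using H[OF s, of n] u(2)[OF s] unfolding isLub_UNIV_iff by auto
  have FH: "increases_to (\<lambda>N. F n N s) (H n s)" if s: "s \<in> space M" for n s
  proof -
    have "(\<lambda>k. h (n + k) s) ` UNIV = (\<lambda>k. h k s) ` {n..}"
      by (force simp: image_iff le_iff_add)
    then show ?thesis unfolding F_def using H[OF s, of n] by (intro increases_to_partial_sup) simp
  qed
  have F_nonneg: "0 \<le> F n N s" if s: "s \<in> space M" for n N s
    unfolding F_def using nonneg[OF s, of "n + 0"] partial_sup_upper[of 0 N "\<lambda>k. h (n + k) s"] by (auto intro: order_trans)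
  \<comment> \<open>The indices from \<open>n + 1\<close> to \<open>n + 1 + N\<close> are among
    those from \<open>n\<close> to \<open>n + Suc N\<close>.\<close>
  have F_Suc: "F (Suc n) N s \<le> F n (Suc N) s" for n N s
    unfolding F_def
  proof (rule partial_sup_least)
    fix k assume "k \<le> N"
    then show "h (Suc n + k) s \<le> partial_sup (\<lambda>k. h (n + k) s) (Suc N)"
      using partial_sup_upper[of "Suc k" "Suc N" "\<lambda>k. h (n + k) s"] by simp
  qed
  have \<alpha>U: "\<alpha> n N \<le> U" for n N
  proof (rule has_diff_integral_mono[OF \<alpha> has_diff_integral_has_pos_integral[OF u(1)]])
    show "F n N s \<le> u s" if s: "s \<in> space M" for s
      using increases_toD(2)[OF FH[OF s]] Hu[OF s] by (rule order_trans)
  qed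
  define A where "A n = Sup (range (\<alpha> n))" for n
  have A: "increases_to (\<alpha> n) (A n)" for n
    unfolding A_def
  proof (rule increases_to_Sup[OF _ \<alpha>U])
    show "\<alpha> n N \<le> \<alpha> n (Suc N)" for N
      by (rule has_diff_integral_mono[OF \<alpha> \<alpha>]) (simp add: F_def)
  qed
  have A_Suc: "A (Suc n) \<le> A n" for n
  proof (rule increases_toD(3)[OF A])
    fix N
    have "\<alpha> (Suc n) N \<le> \<alpha> n (Suc N)" by (rule has_diff_integral_mono[OF \<alpha> \<alpha> F_Suc])
    also have "\<dots> \<le> A n" by (rule increases_toD(2)[OF A])
    finally show "\<alpha> (Suc n) N \<le> A n" .
  qed
  have A_nonneg: "0 \<le> A n" for n
  proof (rule order_trans)
    show "0 \<le> \<alpha> n 0"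
      by (rule has_diff_integral_mono[OF has_diff_integral_has_pos_integral[OF has_pos_integral_zero] \<alpha> F_nonneg])
    show "\<alpha> n 0 \<le> A n" by (rule increases_toD(2)[OF A])
  qed
  define \<beta> where "\<beta> = Inf (range A)"
  have A\<beta>: "decreases_to A \<beta>"
    unfolding \<beta>_def by (rule decreases_to_Inf[where l=0]) (fact A_Suc A_nonneg)+
  \<comment> \<open>The sequence \<open>F n\<close> starts at index \<open>Suc N\<close> so that
    \<open>F_Suc\<close> makes every term nonnegative. Below, \<open>F (Suc n) N\<close> is replaced
    by the larger \<open>H (Suc n)\<close>, and then \<open>N\<close> grows in the bound
    alone.\<close>
  have "outer_integral_le (\<lambda>s. H n s - F (Suc n) N s) (A n - \<alpha> (Suc n) N)" for n N
  proof (rule outer_integral_le_increasing)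
    fix k
    show "has_diff_integral (\<lambda>s. F n (k + Suc N) s - F (Suc n) N s) (\<alpha> n (k + Suc N) - \<alpha> (Suc n) N)"
      by (rule has_diff_integral_diff[OF \<alpha> \<alpha>])
    show "\<alpha> n (k + Suc N) - \<alpha> (Suc n) N \<le> A n - \<alpha> (Suc n) N"
      by (intro diff_right_mono increases_toD(2)[OF A])
  next
    fix s assume s: "s \<in> space M"
    show "0 \<le> F n (0 + Suc N) s - F (Suc n) N s" using F_Suc by simp
    show "increases_to (\<lambda>k. F n (k + Suc N) s - F (Suc n) N s) (H n s - F (Suc n) N s)"
      using increases_to_add[OF increases_to_offset[OF FH[OF s], of n "Suc N"] increases_to_const[of "- F (Suc n) N s"]]
      by simp
    have "H n s - F (Suc n) N s \<le> H n s" using F_nonneg[OF s] by simp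
    then show "H n s - F (Suc n) N s \<le> u s" using Hu[OF s] by (rule order_trans)
  qed (rule u(1))
  then have "outer_integral_le (\<lambda>s. H n s - H (Suc n) s) (A n - \<alpha> (Suc n) N)" for n N
    by (rule outer_integral_le_mono) (intro diff_left_mono increases_toD(2)[OF FH])
  then have "outer_integral_le (\<lambda>s. H n s - H (Suc n) s) (A n - A (Suc n))" for n
    using decreases_to_diff_const_left[OF A]
    by (rule outer_integral_le_decreasing) (use decreases_toD(1)[OF null] in simp)
  \<comment> \<open>Both sides telescope. The functions sum to all of \<open>H 0\<close> because
    \<open>H n\<close> decreases to \<open>0\<close>, while the bounds only sum to
    \<open>A 0 - A n\<close>.\<close>
  then have "outer_integral_le (H 0) (A 0 - \<beta>)"
  proof (rule outer_integral_le_sums[OF _ _ u(1) Hu])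
    show "increases_to (\<lambda>n. \<Sum>k<n. H k s - H (Suc k) s) (H 0 s)" if s: "s \<in> space M" for s
      using increases_to_diff_const_left[OF null[OF s], of "H 0 s"]
      by (simp add: sum_lessThan_telescope'[of "\<lambda>k. H k s"])
    show "(\<Sum>k<n. A k - A (Suc k)) \<le> A 0 - \<beta>" for n
      unfolding sum_lessThan_telescope' by (intro diff_left_mono decreases_toD(2)[OF A\<beta>])
  qed
  then have "outer_integral_le (F 0 N) (A 0 - \<beta>)" for N
    by (rule outer_integral_le_mono) (rule increases_toD(2)[OF FH])
  then have "\<alpha> 0 N \<le> A 0 - \<beta>" for N
    by (rule has_diff_integral_le_outer[OF \<alpha>])
  then have "A 0 \<le> A 0 - \<beta>" by (rule increases_toD(3)[OF A])
  then have "\<beta> \<le> 0" by simp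
  moreover have "0 \<le> \<beta>" by (rule decreases_toD(3)[OF A\<beta> A_nonneg])
  ultimately have "decreases_to A 0" using A\<beta> by simp
  moreover have "a k \<le> A n" if "n \<le> k" for n k
  proof (rule order_trans)
    show "a k \<le> \<alpha> n (k - n)"
      using partial_sup_upper[of "k - n" "k - n" "\<lambda>i. h (n + i) _"] that
      by (intro has_diff_integral_mono[OF h \<alpha>]) (simp add: F_def)
    show "\<alpha> n (k - n) \<le> A n" by (rule increases_toD(2)[OF A])
  qed
  ultimately show ?thesis by blast
qed

end

subsection \<open>The integrals of the theorem\<close>

text \<open>The gap between tail supremum and tail infimum is a null sequence, and both
  \<open>X k\<close> and \<open>x\<close> lie in that gap.\<close>

lemma order_convergesE:
  fixes x :: "'l::dedekind_complete_unital_f_algebra"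
  assumes "order_converges X x"
  obtains Z where "decreases_to Z 0" "\<And>n k. n \<le> k \<Longrightarrow> \<bar>X k - x\<bar> \<le> Z n"
proof -
  obtain U where U: "\<And>n. isLub UNIV (X ` {n..}) (U n)" "isGlb UNIV (range U) x"
    using assms unfolding order_converges_def is_limsup_def by blast
  obtain V where V: "\<And>n. isGlb UNIV (X ` {n..}) (V n)" "isLub UNIV (range V) x"
    using assms unfolding order_converges_def is_liminf_def by blast
  have XU: "X k \<le> U n" and VX: "V n \<le> X k" if "n \<le> k" for n k
    using U(1)[of n] V(1)[of n] that unfolding isLub_UNIV_iff isGlb_UNIV_iff by auto
  have "U (Suc n) \<le> U n" for n
    using U(1)[of "Suc n"] XU[of n] unfolding isLub_UNIV_iff by auto
  then have decU: "decreases_to U x"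
    using U(2) by (simp add: decreases_to_def decseq_SucI)
  have "V n \<le> V (Suc n)" for n
    using V(1)[of "Suc n"] VX[of n] unfolding isGlb_UNIV_iff by auto
  then have incV: "increases_to V x"
    using V(2) by (simp add: increases_to_def incseq_SucI)
  show thesis
  proof
    have "decreases_to (\<lambda>n. (U n + - x) + (x - V n)) ((x + - x) + (x - x))"
      by (intro decreases_to_add decreases_to_diff_const_left incV decU decreases_to_const)
    then show "decreases_to (\<lambda>n. U n - V n) 0" by simp
    fix n k :: nat assume nk: "n \<le> k"
    show "\<bar>X k - x\<bar> \<le> U n - V n"
    proof (rule abs_leI)
      show "X k - x \<le> U n - V n"
        by (rule diff_mono[OF XU[OF nk] increases_toD(2)[OF incV]])
      show "- (X k - x) \<le> U n - V n"
        using diff_mono[OF decreases_toD(2)[OF decU] VX[OF nk]] by simp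
    qed
  qed
qed

lemma order_convergesI:
  fixes x :: "'l::dedekind_complete_unital_f_algebra"
  assumes Z: "decreases_to Z 0" and le: "\<And>n k. n \<le> k \<Longrightarrow> \<bar>X k - x\<bar> \<le> Z n"
  shows "order_converges X x"
proof -
  have upper: "X k \<le> x + Z n" and lower: "x - Z n \<le> X k" if "n \<le> k" for n k
    using le[OF that] abs_le_D1[of "X k - x" "Z n"] abs_le_D2[of "X k - x" "Z n"]
    by (simp_all add: algebra_simps)
  have limit_le: "x \<le> y" if "\<And>n. x - Z n \<le> y" for y
    using decreases_toD(3)[OF Z, of "x - y"] that by (simp add: algebra_simps)
  have le_limit: "y \<le> x" if "\<And>n. y \<le> x + Z n" for y
    using decreases_toD(3)[OF Z, of "y - x"] that by (simp add: algebra_simps)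
  \<comment> \<open>Every tail contains terms with error at most \<open>Z n\<close>, for each
    \<open>n\<close>. This keeps the tail suprema above \<open>x\<close> and the tail infima below
    it.\<close>
  have tail: "\<exists>k\<ge>m. Z k \<le> Z n" for m n
    using decreases_toD(1)[OF Z, of n "max m n"] by (intro exI[of _ "max m n"]) simp
  let ?U = "\<lambda>n. Sup (X ` {n..})"
  have U: "isLub UNIV (X ` {n..}) (?U n)" for n
    by (rule Sup_isLub) (auto intro: upper)
  have "x \<le> ?U m" for m
  proof (rule limit_le)
    fix n
    obtain k where k: "m \<le> k" "Z k \<le> Z n" using tail by blast
    have "x - Z n \<le> x - Z k" by (rule diff_left_mono[OF k(2)])
    also have "\<dots> \<le> X k" by (rule lower) simp
    also have "\<dots> \<le> ?U m" using U[of m] k(1) unfolding isLub_UNIV_iff by auto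
    finally show "x - Z n \<le> ?U m" .
  qed
  moreover have "?U n \<le> x + Z n" for n
    using U[of n] upper[of n] unfolding isLub_UNIV_iff by auto
  then have "y \<le> x" if "\<And>n. y \<le> ?U n" for y
    using that by (intro le_limit) (blast intro: order_trans)
  ultimately have "isGlb UNIV (range ?U) x" unfolding isGlb_UNIV_iff by blast
  with U have "is_limsup UNIV X x" unfolding is_limsup_def by (intro exI[of _ ?U] conjI allI)
  let ?V = "\<lambda>n. Inf (X ` {n..})"
  have V: "isGlb UNIV (X ` {n..}) (?V n)" for n
    by (rule Inf_isGlb) (auto intro: lower)
  have "?V m \<le> x" for m
  proof (rule le_limit)
    fix n
    obtain k where k: "m \<le> k" "Z k \<le> Z n" using tail by blast
    have "?V m \<le> X k" using V[of m] k(1) unfolding isGlb_UNIV_iff by auto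
    also have "\<dots> \<le> x + Z k" by (rule upper) simp
    also have "\<dots> \<le> x + Z n" by (rule add_left_mono[OF k(2)])
    finally show "?V m \<le> x + Z n" .
  qed
  moreover have "x - Z n \<le> ?V n" for n
    using V[of n] lower[of n] unfolding isGlb_UNIV_iff by auto
  then have "x \<le> y" if "\<And>n. ?V n \<le> y" for y
    using that by (intro limit_le) (blast intro: order_trans)
  ultimately have "isLub UNIV (range ?V) x" unfolding isLub_UNIV_iff by blast
  with V have "is_liminf UNIV X x" unfolding is_liminf_def by (intro exI[of _ ?V] conjI allI)
  with \<open>is_limsup UNIV X x\<close> show ?thesis unfolding order_converges_def by blast
qed

section \<open>Suprema and infima in the extended positive cone\<close>

lemma isLub_extended_cone_iff:
  "isLub extended_cone A x \<longleftrightarrow> x \<in> extended_cone \<and> (\<forall>a\<in>A. a \<le> x) \<and>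
     (\<forall>y\<in>extended_cone. (\<forall>a\<in>A. a \<le> y) \<longrightarrow> x \<le> y)"
  unfolding isLub_def isUb_def leastP_def setle_def setge_def by auto

lemma isGlb_extended_cone_iff:
  "isGlb extended_cone A x \<longleftrightarrow> x \<in> extended_cone \<and> (\<forall>a\<in>A. x \<le> a) \<and>
     (\<forall>y\<in>extended_cone. (\<forall>a\<in>A. y \<le> a) \<longrightarrow> y \<le> x)"
  unfolding isGlb_def isLb_def greatestP_def setle_def setge_def by auto

text \<open>An upper bound of a nonempty set of nonnegative elements is nonnegative, so passing to
  the cone loses no upper bound, and the added \<open>Pinf\<close> lies above \<open>Fin x\<close>
  anyway.\<close>

lemma isLub_extended_cone_Fin:
  assumes "A \<noteq> {}" "\<And>a. a \<in> A \<Longrightarrow> 0 \<le> a"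
  shows "isLub extended_cone (Fin ` A) (Fin x) \<longleftrightarrow> isLub UNIV A x"
proof -
  have nonneg: "0 \<le> y" if "\<forall>a\<in>A. a \<le> y" for y
    using assms that by (meson all_not_in_conv order_trans)
  have "(\<forall>y\<in>extended_cone. (\<forall>a\<in>Fin ` A. a \<le> y) \<longrightarrow> Fin x \<le> y) \<longleftrightarrow>
      (\<forall>y. (\<forall>a\<in>A. a \<le> y) \<longrightarrow> x \<le> y)"
    using nonneg by (auto simp: extended_cone_def)
  then show ?thesis
    unfolding isLub_extended_cone_iff isLub_UNIV_iff using nonneg by (auto simp: extended_cone_def)
qed

lemma is_limsup_extended_cone_Fin:
  assumes lim: "is_limsup UNIV X 0" and nonneg: "\<And>n. 0 \<le> X n"
  shows "is_limsup extended_cone (\<lambda>n. Fin (X n)) (Fin 0)"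
proof -
  obtain U where U: "\<And>n. isLub UNIV (X ` {n..}) (U n)" "isGlb UNIV (range U) 0"
    using lim unfolding is_limsup_def by blast
  have "isLub extended_cone ((\<lambda>n. Fin (X n)) ` {n..}) (Fin (U n))" for n
  proof -
    have "isLub extended_cone (Fin ` X ` {n..}) (Fin (U n)) \<longleftrightarrow> isLub UNIV (X ` {n..}) (U n)"
      by (rule isLub_extended_cone_Fin) (use nonneg in auto)
    then show ?thesis using U(1) by (simp add: image_image)
  qed
  moreover have "isGlb extended_cone (range (\<lambda>n. Fin (U n))) (Fin 0)"
    using U(2) unfolding isGlb_extended_cone_iff isGlb_UNIV_iff by (auto simp: extended_cone_def)
  ultimately show ?thesis
    unfolding is_limsup_def by (intro exI[of _ "\<lambda>n. Fin (U n)"] conjI allI)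
qed

section \<open>Agreement of the defined integrals with the relational ones\<close>

context proper_L_measure_space
begin

text \<open>The predicate under the description operator of \<open>positive_integral\<close>,
  isolated in order to prove existence and uniqueness of its value.\<close>

definition extended_integral :: "('s \<Rightarrow> 'l) \<Rightarrow> 'l extended \<Rightarrow> bool" where
  "extended_integral f I \<longleftrightarrow> (\<exists>\<phi>. (\<forall>n. \<phi> n \<in> unit_ideal_step M) \<and>
     (\<forall>s\<in>space M. increases_to (\<lambda>n. \<phi> n s) (f s)) \<and>
     isLub extended_cone (range (\<lambda>n. Fin (I\<^sub>s (\<phi> n)))) I)"

lemma isLub_step_integrals_iff:
  assumes "\<And>n. \<phi> n \<in> unit_ideal_step M" "\<And>s. s \<in> space M \<Longrightarrow> increases_to (\<lambda>n. \<phi> n s) (f s)"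
  shows "isLub extended_cone (range (\<lambda>n. Fin (I\<^sub>s (\<phi> n)))) (Fin j) \<longleftrightarrow> increases_to (\<lambda>n. I\<^sub>s (\<phi> n)) j"
proof -
  have "incseq (\<lambda>n. I\<^sub>s (\<phi> n))"
    by (intro incseq_SucI step_integral_mono unit_ideal_stepD(1)[OF assms(1)] increases_toD(1)[OF assms(2)]) auto
  moreover have "isLub extended_cone (Fin ` range (\<lambda>n. I\<^sub>s (\<phi> n))) (Fin j) \<longleftrightarrow>
      isLub UNIV (range (\<lambda>n. I\<^sub>s (\<phi> n))) j"
    by (rule isLub_extended_cone_Fin) (use step_integral_nonneg[OF assms(1)] in auto)
  ultimately show ?thesis by (simp add: increases_to_def image_image)
qed

lemma extended_integral_Fin_iff: "extended_integral f (Fin j) \<longleftrightarrow> has_pos_integral f j"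
  unfolding extended_integral_def has_pos_integral_def
  using isLub_step_integrals_iff by meson

text \<open>The two cases exclude each other, since a finite integral along one sequence bounds the
  step integrals along any other. The bottom element \<open>Minf\<close> is not in
  \<open>extended_cone\<close>.\<close>

lemma extended_integral_cases:
  assumes "extended_integral f I"
  obtains j where "I = Fin j" "has_pos_integral f j" | "I = Pinf" "\<And>j. \<not> has_pos_integral f j"
proof (cases I)
  case (Fin j)
  then show thesis using that(1) assms extended_integral_Fin_iff by blast
next
  case Pinf
  have False if j: "has_pos_integral f j" for j
  proof -
    obtain \<phi> where \<phi>: "\<And>n. \<phi> n \<in> unit_ideal_step M"
      "\<And>s. s \<in> space M \<Longrightarrow> increases_to (\<lambda>n. \<phi> n s) (f s)"
      "isLub extended_cone (range (\<lambda>n. Fin (I\<^sub>s (\<phi> n)))) Pinf"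
      using assms Pinf unfolding extended_integral_def by blast
    have "I\<^sub>s (\<phi> n) \<le> j" for n
      by (rule step_integral_le_has_pos_integral[OF \<phi>(1) j increases_toD(2)[OF \<phi>(2)]])
    then have "\<forall>a\<in>range (\<lambda>n. Fin (I\<^sub>s (\<phi> n))). a \<le> Fin j" by auto
    moreover have "Fin j \<in> extended_cone"
      using has_pos_integral_integral_nonneg[OF j] by (simp add: extended_cone_def)
    ultimately have "Pinf \<le> Fin j" using \<phi>(3) unfolding isLub_extended_cone_iff by blast
    then show False by simp
  qed
  then show thesis using that(2) Pinf by blast
next
  case Minf
  then show thesis
    using assms unfolding extended_integral_def isLub_extended_cone_iff by (auto simp: extended_cone_def)
qed

lemma extended_integral_unique:
  assumes "extended_integral f I" "extended_integral f J"
  shows "I = J"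
proof -
  have "i = j" if "has_pos_integral f i" "has_pos_integral f j" for i j
    using that[THEN has_diff_integral_has_pos_integral] by (rule has_diff_integral_unique)
  then show ?thesis
    using extended_integral_cases[OF assms(1)] extended_integral_cases[OF assms(2)] by metis
qed

lemma extended_integral_exists:
  assumes "f \<in> positive_measurable M"
  shows "\<exists>I. extended_integral f I"
proof -
  obtain \<phi> where \<phi>: "\<And>n. \<phi> n \<in> unit_ideal_step M"
    "\<And>s. s \<in> space M \<Longrightarrow> increases_to (\<lambda>n. \<phi> n s) (f s)"
    using positive_measurable_unit_ideal_step[OF assms] by blast
  show ?thesis
  proof (cases "\<exists>B. \<forall>n. I\<^sub>s (\<phi> n) \<le> B")
    case True
    then obtain B where "\<And>n. I\<^sub>s (\<phi> n) \<le> B" by blast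
    from has_pos_integral_lim[OF \<phi> this] show ?thesis
      using extended_integral_Fin_iff by blast
  next
    case False
    have "isLub extended_cone (range (\<lambda>n. Fin (I\<^sub>s (\<phi> n)))) Pinf"
      unfolding isLub_extended_cone_iff using False by (auto simp: extended_cone_def)
    then have "extended_integral f Pinf"
      unfolding extended_integral_def using \<phi> by blast
    then show ?thesis by blast
  qed
qed

lemma positive_integral_eqI: "extended_integral f I \<Longrightarrow> positive_integral M \<mu> f = I"
  unfolding positive_integral_def extended_integral_def[symmetric]
  by (rule the_equality) (auto intro: extended_integral_unique)

lemma positive_integral_eq_Fin_iff:
  assumes "f \<in> positive_measurable M"
  shows "positive_integral M \<mu> f = Fin j \<longleftrightarrow> has_pos_integral f j"
  using extended_integral_exists[OF assms] positive_integral_eqI extended_integral_Fin_iff by metis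

lemma has_pos_integral_iff:
  "has_pos_integral f j \<longleftrightarrow> f \<in> positive_measurable M \<and> positive_integral M \<mu> f = Fin j"
  using positive_integral_eq_Fin_iff has_pos_integral_positive_measurable by blast

text \<open>Both branches of the definition give \<open>a\<close>. In the first,
  \<open>h \<le> u\<close> makes the integral finite and uniqueness identifies it; in the second,
  uniqueness resolves the description.\<close>

lemma nonneg_integral_eq:
  assumes h: "has_diff_integral h a" and nonneg: "\<And>s. s \<in> space M \<Longrightarrow> 0 \<le> h s"
  shows "nonneg_integral M \<mu> h = Fin a"
proof (cases "h \<in> positive_measurable M")
  case True
  obtain u v b c where uv: "has_pos_integral u b" "has_pos_integral v c"
    "\<And>s. s \<in> space M \<Longrightarrow> h s = u s - v s" "a = b - c"
    using has_diff_integralE[OF h] by metis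
  have "h s \<le> u s" if "s \<in> space M" for s
    using uv(3)[OF that] has_pos_integral_nonneg[OF uv(2) that] by simp
  then obtain j where j: "has_pos_integral h j"
    using has_pos_integral_dominated[OF True uv(1)] by blast
  have "j = a"
    by (rule has_diff_integral_unique[OF has_diff_integral_has_pos_integral[OF j] h])
  then show ?thesis using True j by (simp add: has_pos_integral_iff nonneg_integral_def)
next
  case False
  have "(\<exists>u\<in>positive_measurable M. \<exists>v\<in>positive_measurable M. \<exists>b c.
      (\<forall>s\<in>space M. h s = u s - v s) \<and> positive_integral M \<mu> u = Fin b \<and>
      positive_integral M \<mu> v = Fin c \<and> I = Fin (b - c)) \<longleftrightarrow> (\<exists>d. has_diff_integral h d \<and> I = Fin d)" for I
    unfolding has_diff_integral_def has_pos_integral_iff by blast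
  moreover have "(THE I. \<exists>d. has_diff_integral h d \<and> I = Fin d) = Fin a"
    using h has_diff_integral_unique by (intro the_equality) blast+
  ultimately show ?thesis using False by (simp add: nonneg_integral_def)
qed

lemma L_integrable_dominated:
  assumes f: "L_measurable M f" and u: "has_pos_integral u U"
    and le: "\<And>s. s \<in> space M \<Longrightarrow> \<bar>f s\<bar> \<le> u s"
  shows "L_integrable M \<mu> f" and "has_diff_integral f (L_integral M \<mu> f)"
proof -
  have pm: "(\<lambda>s. pprt (f s)) \<in> positive_measurable M" "(\<lambda>s. pprt (- f s)) \<in> positive_measurable M"
    using f unfolding L_measurable_def by auto
  have "pprt (f s) \<le> u s" "pprt (- f s) \<le> u s" if "s \<in> space M" for s
    using order_trans[OF _ le[OF that]] abs_eq_pprt_add[of "f s"] by auto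
  then obtain a b where a: "has_pos_integral (\<lambda>s. pprt (f s)) a"
    and b: "has_pos_integral (\<lambda>s. pprt (- f s)) b"
    using has_pos_integral_dominated[OF pm(1) u] has_pos_integral_dominated[OF pm(2) u] by blast
  have "has_pos_integral (\<lambda>s. \<bar>f s\<bar>) (a + b)"
    using has_pos_integral_add[OF a b] unfolding abs_eq_pprt_add .
  then show "L_integrable M \<mu> f"
    unfolding L_integrable_def using f by (simp add: has_pos_integral_iff)
  have "L_integral M \<mu> f = a - b"
    using a b by (simp add: has_pos_integral_iff L_integral_def the_Fin_def)
  then show "has_diff_integral f (L_integral M \<mu> f)"
    using has_diff_integralI[OF a b] unfolding eq_pprt_diff[symmetric] by simp
qed

end

theorem theorem6p4:
  fixes M :: "'s measure"
    and \<mu> :: "'s set \<Rightarrow> 'l::dedekind_complete_unital_f_algebra"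
    and f :: "nat \<Rightarrow> 's \<Rightarrow> 'l" and f_lim g :: "'s \<Rightarrow> 'l"
  assumes "finite_L_measure M \<mu>"
    and "proper_L_measure M \<mu>"
    and "\<And>n. L_measurable M (f n)"
    and "L_measurable M f_lim"
    and "\<And>s. s \<in> space M \<Longrightarrow> order_converges (\<lambda>n. f n s) (f_lim s)"
    and "L_integrable M \<mu> g"
    and "\<And>n s. s \<in> space M \<Longrightarrow> \<bar>f n s\<bar> \<le> g s"
  shows "(L_integrable M \<mu> f_lim \<and> (\<forall>n. L_integrable M \<mu> (f n))) \<and>
    is_limsup extended_cone (\<lambda>k. nonneg_integral M \<mu> (\<lambda>s. \<bar>f k s - f_lim s\<bar>)) (Fin 0) \<and>
    is_liminf UNIV (\<lambda>k. L_integral M \<mu> (f k)) (L_integral M \<mu> f_lim) \<and>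
    is_limsup UNIV (\<lambda>k. L_integral M \<mu> (f k)) (L_integral M \<mu> f_lim)"
proof -
  interpret proper_L_measure_space M \<mu>
    by standard (fact assms)+
  note conv = assms(5)
  have g_pm: "(\<lambda>s. \<bar>g s\<bar>) \<in> positive_measurable M"
    using assms(6) positive_measurable_add unfolding L_integrable_def L_measurable_def abs_eq_pprt_add by blast
  obtain jg where jg: "has_pos_integral (\<lambda>s. \<bar>g s\<bar>) jg"
    using assms(6) positive_integral_eq_Fin_iff[OF g_pm] unfolding L_integrable_def by auto
  have f_le: "\<bar>f n s\<bar> \<le> \<bar>g s\<bar>" if "s \<in> space M" for n s
    using assms(7)[OF that] abs_ge_self by (rule order_trans)
  \<comment> \<open>The bound passes to the limit because the excess of
    \<open>\<bar>f_lim s\<bar>\<close> over \<open>\<bar>g s\<bar>\<close> is at most every term of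
    a null sequence.\<close>
  have lim_le: "\<bar>f_lim s\<bar> \<le> \<bar>g s\<bar>" if s: "s \<in> space M" for s
  proof -
    obtain Z where Z: "decreases_to Z 0" "\<And>n k. n \<le> k \<Longrightarrow> \<bar>f k s - f_lim s\<bar> \<le> Z n"
      using order_convergesE[OF conv[OF s]] by metis
    have "\<bar>f_lim s\<bar> - \<bar>g s\<bar> \<le> Z n" for n
    proof -
      have "\<bar>f_lim s\<bar> = \<bar>f n s - (f n s - f_lim s)\<bar>" by simp
      also have "\<dots> \<le> \<bar>f n s\<bar> + \<bar>f n s - f_lim s\<bar>" by (rule abs_triangle_ineq4)
      also have "\<dots> \<le> \<bar>g s\<bar> + Z n" by (intro add_mono f_le s Z(2)) simp
      finally show ?thesis by (simp add: algebra_simps)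
    qed
    from decreases_toD(3)[OF Z(1) this] show ?thesis by simp
  qed
  note f_int = L_integrable_dominated[OF assms(3) jg f_le]
  note lim_int = L_integrable_dominated[OF assms(4) jg lim_le]

  let ?h = "\<lambda>k s. \<bar>f k s - f_lim s\<bar>"
  have diff_int: "has_diff_integral (\<lambda>s. f k s - f_lim s) (L_integral M \<mu> (f k) - L_integral M \<mu> f_lim)" for k
    by (intro has_diff_integral_diff f_int(2) lim_int(2))
  have minus_int: "has_diff_integral (\<lambda>s. - (f k s - f_lim s)) (- (L_integral M \<mu> (f k) - L_integral M \<mu> f_lim))" for k
    using has_diff_integral_diff[OF lim_int(2) f_int(2)[of k]] by simp
  \<comment> \<open>An absolute value is the supremum of a difference and its negative, so it stays
    in the class of differences even where it leaves \<open>positive_measurable\<close>.\<close>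
  have "\<exists>d. has_diff_integral (?h k) d" for k
    unfolding abs_lattice by (rule has_diff_integral_sup[OF diff_int minus_int])
  then obtain a where a: "\<And>k. has_diff_integral (?h k) (a k)" by metis
  have a_nonneg: "0 \<le> a k" for k
    by (rule has_diff_integral_mono[OF has_diff_integral_has_pos_integral[OF has_pos_integral_zero] a]) simp
  \<comment> \<open>Through this estimate the null bound for \<open>a\<close> also controls the
    integrals of the \<open>f k\<close>.\<close>
  have abs_le: "\<bar>L_integral M \<mu> (f k) - L_integral M \<mu> f_lim\<bar> \<le> a k" for k
    by (intro abs_leI has_diff_integral_mono[OF diff_int a] has_diff_integral_mono[OF minus_int a])
       (rule abs_ge_self abs_ge_minus_self)+

  have h_le: "?h k s \<le> \<bar>g s\<bar> + \<bar>g s\<bar>" if "s \<in> space M" for k s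
    by (rule order_trans[OF abs_triangle_ineq4 add_mono[OF f_le[OF that] lim_le[OF that]]])
  let ?H = "\<lambda>n s. Sup ((\<lambda>k. ?h k s) ` {n..})"
  have H: "isLub UNIV ((\<lambda>k. ?h k s) ` {n..}) (?H n s)" if "s \<in> space M" for n s
    using h_le[OF that] by (intro Sup_isLub) auto
  have "decreases_to (\<lambda>n. ?H n s) 0" if s: "s \<in> space M" for s
  proof -
    obtain Z where Z: "decreases_to Z 0" "\<And>n k. n \<le> k \<Longrightarrow> \<bar>f k s - f_lim s\<bar> \<le> Z n"
      using order_convergesE[OF conv[OF s]] by metis
    have upper: "?h k s \<le> ?H n s" if "n \<le> k" for n k
      using H[OF s, of n] that unfolding isLub_UNIV_iff by auto
    have least: "?H n s \<le> y" if "\<And>k. n \<le> k \<Longrightarrow> ?h k s \<le> y" for n y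
      using H[OF s, of n] that unfolding isLub_UNIV_iff by auto
    show ?thesis
    proof (rule decreases_toI)
      show "?H (Suc n) s \<le> ?H n s" for n by (intro least upper) simp
      show "0 \<le> ?H n s" for n by (rule order_trans[OF abs_ge_zero upper[OF order_refl]])
      fix y assume y: "\<And>n. y \<le> ?H n s"
      have "y \<le> Z n" for n by (rule order_trans[OF y least[OF Z(2)]])
      then show "y \<le> 0" by (rule decreases_toD(3)[OF Z(1)])
    qed
  qed
  from dominated_null_sequence[OF a abs_ge_zero has_pos_integral_add[OF jg jg] h_le H this]
  obtain A where A: "decreases_to A 0" "\<And>n k. n \<le> k \<Longrightarrow> a k \<le> A n" by blast

  have "order_converges (\<lambda>k. L_integral M \<mu> (f k)) (L_integral M \<mu> f_lim)"
    using A(1) by (rule order_convergesI) (rule order_trans[OF abs_le A(2)])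
  moreover have "order_converges a 0"
    using A(1) by (rule order_convergesI) (simp add: a_nonneg A(2))
  then have "is_limsup extended_cone (\<lambda>k. Fin (a k)) (Fin 0)"
    using a_nonneg by (intro is_limsup_extended_cone_Fin) (auto simp: order_converges_def)
  moreover have "nonneg_integral M \<mu> (?h k) = Fin (a k)" for k
    by (rule nonneg_integral_eq[OF a]) simp
  ultimately show ?thesis
    using f_int(1) lim_int(1) by (simp add: order_converges_def)
qed

end
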